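(* Let $f=h+\overline{g}\in\mathcal{S}_H(\mathcal{S})$ with $b_1=f_{\overline{z}}(0)$. Then for any $z$ with $0<|z|=r<1$ the inequalities $$|h'(z)|\le(1+r|b_1|)\frac{1+r}{(1-r)^4}\qquad\text{and}\qquad|g'(z)|\le(r+|b_1|)\frac{1+r}{(1-r)^4}$$ hold. These bounds are sharp. Equality is attained for the close-to-convex functions of the form $f(z)=K(z)+\overline{b_1K(z)}$, where $K$ is the harmonic Koebe function $$K(z)=\frac{z-\frac12z^2+\frac16z^3}{(1-z)^3}+\overline{\left(\frac{\frac12z^2+\frac16z^3}{(1-z)^3}\right)}.$$
   Context: $\mathbb{D}=\{z\in\mathbb{C}:|z|<1\}$. $\mathcal{H}$ is the class of complex-valued harmonic functions $f=h+\overline{g}$ in $\mathbb{D}$ with $h,g$ analytic in $\mathbb{D}$, $h(0)=g(0)=0$, $h'(0)=1$. Such an $f$ is (locally univalent and) sense-preserving if $|h'(z)|^2-|g'(z)|^2>0$ for all $z\in\mathbb{D}$. $\mathcal{S}_H$ is the class of all sense-preserving univalent (injective) $f\in\mathcal{H}$, and $\mathcal{S}^0_H$ is the class of $f\in\mathcal{S}_H$ with $f_{\overline{z}}(0)=0$ (i.e. $g'(0)=0$). $\mathcal{S}$ is the class of analytic univalent functions $\varphi$ on $\mathbb{D}$ with $\varphi(0)=0$, $\varphi'(0)=1$. Define $$\mathcal{S}^0_H(\mathcal{S})=\{h+\overline{g}\in\mathcal{S}^0_H:\ h+e^{i\theta}g\in\mathcal{S}\text{ for some }\theta\in\mathbb{R}\},$$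 $$\mathcal{S}_H(\mathcal{S})=\{f=f_0+c\,\overline{f_0}:\ f_0\in\mathcal{S}^0_H(\mathcal{S}),\ c\in\mathbb{D}\}.$$ A function in $\mathcal{S}_H$ is close-to-convex if its range $f(\mathbb{D})$ is a close-to-convex domain (its complement is a union of closed half-lines with pairwise disjoint interiors).
   Formalization: Equality for f = K + conj(b_1 K) is stated only for real 0 ≤ b_1 < 1 (at z = r), as it fails for every other b_1 (e.g. b_1 = -1/2); sharpness for each b_1 in D is stated via some f in S_H(S). For this family f_zbar(0) is conj(b_1). *)

theory Defs
  imports "HOL-Complex_Analysis.Complex_Analysis"
begin

abbreviation unit_disk :: "complex set" where
  "unit_disk \<equiv> ball 0 1"

text \<open>
  Functions on the disk are total functions of type \<open>complex \<Rightarrow> complex\<close>; only their values on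
  the disk matter.  A normalised harmonic function determines its analytic part \<open>h\<close> and its
  co-analytic part \<open>g\<close> uniquely on the disk, because \<open>h 0 = g 0 = 0\<close>.
\<close>

definition harmonic_parts ::
  "(complex \<Rightarrow> complex) \<Rightarrow> (complex \<Rightarrow> complex) \<Rightarrow> (complex \<Rightarrow> complex) \<Rightarrow> bool" where
  "harmonic_parts f h g \<longleftrightarrow>
     h holomorphic_on unit_disk \<and> g holomorphic_on unit_disk \<and>
     h 0 = 0 \<and> g 0 = 0 \<and> deriv h 0 = 1 \<and>
     (\<forall>z\<in>unit_disk. f z = h z + cnj (g z))"

definition class_H :: "(complex \<Rightarrow> complex) set" where
  "class_H = {f. \<exists>h g. harmonic_parts f h g}"

definition sense_preserving :: "(complex \<Rightarrow> complex) \<Rightarrow> bool" where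
  "sense_preserving f \<longleftrightarrow>
     (\<exists>h g. harmonic_parts f h g \<and>
        (\<forall>z\<in>unit_disk. (cmod (deriv h z))\<^sup>2 - (cmod (deriv g z))\<^sup>2 > 0))"

text \<open>The Wirtinger derivative \<open>(f\<^sub>x + \<i> f\<^sub>y) / 2\<close>.\<close>

definition dzbar :: "(complex \<Rightarrow> complex) \<Rightarrow> complex \<Rightarrow> complex" where
  "dzbar f z = (frechet_derivative f (at z) 1 + \<i> * frechet_derivative f (at z) \<i>) / 2"

definition class_SH :: "(complex \<Rightarrow> complex) set" where
  "class_SH = {f \<in> class_H. sense_preserving f \<and> inj_on f unit_disk}"

definition class_SH0 :: "(complex \<Rightarrow> complex) set" where
  "class_SH0 = {f \<in> class_SH. dzbar f 0 = 0}"

definition class_S :: "(complex \<Rightarrow> complex) set" where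
  "class_S = {\<phi>. \<phi> holomorphic_on unit_disk \<and> inj_on \<phi> unit_disk \<and> \<phi> 0 = 0 \<and> deriv \<phi> 0 = 1}"

definition class_SH0_S :: "(complex \<Rightarrow> complex) set" where
  "class_SH0_S =
     {f \<in> class_SH0. \<exists>h g. harmonic_parts f h g \<and>
        (\<exists>\<theta>::real. (\<lambda>z. h z + exp (\<i> * of_real \<theta>) * g z) \<in> class_S)}"

definition class_SH_S :: "(complex \<Rightarrow> complex) set" where
  "class_SH_S =
     {f. \<exists>f0\<in>class_SH0_S. \<exists>c\<in>unit_disk. \<forall>z\<in>unit_disk. f z = f0 z + c * cnj (f0 z)}"

definition closed_half_line :: "complex set \<Rightarrow> bool" where
  "closed_half_line L \<longleftrightarrow> (\<exists>a d. d \<noteq> 0 \<and> L = {a + of_real t * d | t::real. t \<ge> 0})"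

text \<open>
  The interior of a half-line is meant relative to the line, i.e. the half-line without its
  endpoint (its interior in the plane is empty).  The family of half-lines may be empty, so the
  whole plane is close-to-convex.
\<close>

definition close_to_convex_domain :: "complex set \<Rightarrow> bool" where
  "close_to_convex_domain \<Omega> \<longleftrightarrow>
     open \<Omega> \<and> connected \<Omega> \<and> \<Omega> \<noteq> {} \<and>
     (\<exists>\<L>. (\<forall>L\<in>\<L>. closed_half_line L) \<and>
          pairwise (\<lambda>L M. disjnt (rel_interior L) (rel_interior M)) \<L> \<and>
          - \<Omega> = \<Union>\<L>)"

definition close_to_convex :: "(complex \<Rightarrow> complex) \<Rightarrow> bool" where
  "close_to_convex f \<longleftrightarrow> f \<in> class_SH \<and> close_to_convex_domain (f ` unit_disk)"

definition harmonic_koebe :: "complex \<Rightarrow> complex" where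
  "harmonic_koebe z =
     (z - 1/2 * z^2 + 1/6 * z^3) / (1 - z)^3 + cnj ((1/2 * z^2 + 1/6 * z^3) / (1 - z)^3)"

text \<open>Here \<open>dzbar (koebe_affine b) 0\<close> is \<open>cnj b\<close>, not \<open>b\<close>.\<close>

definition koebe_affine :: "complex \<Rightarrow> complex \<Rightarrow> complex" where
  "koebe_affine b z = harmonic_koebe z + cnj (b * harmonic_koebe z)"

end

theory Submission
  imports Defs
begin

text \<open>
  Write \<open>f = f0 + c cnj f0\<close> and \<open>f0 = h0 + cnj g0\<close>, and let \<open>\<phi> = h0 + e g0\<close> with \<open>|e| = 1\<close> be
  univalent.  The dilatation \<open>\<omega> = g0' / h0'\<close> satisfies \<open>|\<omega> z| \<le> |z|\<close> by the Schwarz lemma, and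
  \<open>\<phi>' = h0' (1 + e \<omega>)\<close>, so the upper half \<open>|\<phi>' z| \<le> (1 + r) / (1 - r)\<^sup>3\<close> of the Koebe distortion
  theorem bounds \<open>h0'\<close>, hence also \<open>g0'\<close> and the parts \<open>h0 + c g0\<close>, \<open>g0 + cnj c h0\<close> of \<open>f\<close>.

  The distortion theorem comes from Bieberbach's \<open>|\<phi>'' 0| \<le> 4\<close> through the Koebe transform, and
  Bieberbach's inequality from the area theorem applied to \<open>1 / sqrt (\<phi> (z\<^sup>2))\<close>.

  For sharpness, the Cayley transform \<open>u = x + i y = (1 + z) / (1 - z)\<close> turns the harmonic Koebe
  function into \<open>(x\<^sup>3 - 3 x y\<^sup>2 - 1) / 6 + i x y / 2\<close>, which for a fixed product \<open>x y\<close> is increasing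
  in \<open>x\<close>; so it is injective onto the plane slit along a half-line, and an affine image omits a half-line as well.
\<close>

section \<open>Area theorem\<close>

text \<open>The exponent 4 is 3 + 1: the distortion theorem supplies three factors
  \<open>1 / (1 - r)\<close>, and \<open>|1 + e \<omega>| \<ge> 1 - r\<close> one more. Equality
  needs three things at one point: equality in the distortion theorem, equality in the Schwarz
  lemma, and aligned phases in the triangle inequality for \<open>h0' + c g0'\<close> and
  \<open>g0' + cnj c h0'\<close>. The harmonic Koebe function attains the maximum of
  \<open>|h0'|\<close> on a circle only at the positive point \<open>z = r\<close>, where aligned
  phases force \<open>b \<ge> 0\<close>. For other \<open>b\<close>, \<open>koebe_affine b\<close>
  lies in the classes but stays below the bounds. Hence sharpness for arbitrary \<open>b\<close> is
  shown with rotated Koebe functions, and equality for \<open>koebe_affine\<close> itself is stated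
  for real \<open>0 \<le> b\<close>.

  In the area theorem the image of the annulus \<open>e < |z| < d\<close> has area of order
  \<open>1 / e^2\<close>. This must cancel against the area of the comparison region up to an error
  that vanishes with \<open>e\<close>.\<close>

lemma mean_value_circle:
  assumes f: "f holomorphic_on ball 0 1" and r: "0 < r" "r < 1"
  shows "((\<lambda>t. f (of_real r * cis t)) has_integral (of_real (2 * pi) * f 0)) {0..2*pi}"
proof -
  have "((\<lambda>u. f u / (u - 0)) has_contour_integral (2 * of_real pi * \<i> * f 0)) (circlepath 0 r)"
    using r by (intro Cauchy_integral_circlepath_simple holomorphic_on_subset[OF f]) auto
  then have "((\<lambda>t. f (of_real r * cis t) / (of_real r * cis t) * of_real r * \<i> * cis t) has_integral (2 * of_real pi * \<i> * f 0)) {0..2*pi}"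
    unfolding circlepath_def by (subst (asm) has_contour_integral_part_circlepath_iff) auto
  then have "((\<lambda>t. \<i> * f (of_real r * cis t)) has_integral (\<i> * (of_real (2 * pi) * f 0))) {0..2*pi}"
    using r by (simp add: field_simps)
  from has_integral_mult_right[OF this, of "-\<i>"] show ?thesis
    by (simp add: mult.assoc[symmetric])
qed

text \<open>Carries Fubini for pairs over to \<open>real^2\<close>, where the area of an image is
  computed later. The identification \<open>g\<close> maps boxes to boxes of the same content, hence
  the scaling factor 1.\<close>

lemma integral_real2:
  fixes F :: "real \<Rightarrow> real \<Rightarrow> real" and a b c d :: real
  assumes F: "continuous_on (cbox (a, c) (b, d)) (\<lambda>(s, t). F s t)"
  shows "((\<lambda>v::real^2. F (v$1) (v$2)) has_integral
           integral {a..b} (\<lambda>s. integral {c..d} (F s))) (cbox (vector [a, c]) (vector [b, d]))"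
proof -
  define g where "g = (\<lambda>v::real^2. (v$1, v$2))"
  define h where "h = (\<lambda>(s, t). vector [s, t] :: real^2)"
  have gh: "g (h x) = x" for x by (auto simp: g_def h_def split: prod.splits)
  have hg: "h (g x) = x" for x by (auto simp: g_def h_def vec_eq_iff forall_2)
  have gc: "g ` cbox u v = cbox (g u) (g v)" for u v
  proof -
    have "x \<in> g ` cbox u v" if "x \<in> cbox (g u) (g v)" for x
      by (rule image_eqI[of _ _ "h x"])
         (use that in \<open>auto simp: gh g_def h_def mem_box_cart cbox_Pair_eq forall_2 split: prod.splits\<close>)
    then show ?thesis
      by (auto simp: g_def mem_box_cart cbox_Pair_eq forall_2)
  qed
  have hc: "h ` cbox u v = cbox (h u) (h v)" for u v
    using gc[of "h u" "h v"] by (metis (no_types, lifting) gh hg image_image image_cong image_ident)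
  have cont: "measure lborel (g ` cbox u v) = 1 * measure lborel (cbox u v)" for u v
  proof (cases "\<forall>i. u$i \<le> v$i")
    case True
    then have "measure lborel (cbox u v) = (v$1 - u$1) * (v$2 - u$2)"
      by (subst content_cbox_cart) (auto simp: interval_ne_empty_cart UNIV_2)
    moreover have "measure lborel (g ` cbox u v) = (v$1 - u$1) * (v$2 - u$2)"
      unfolding gc using True by (simp add: g_def content_Pair)
    ultimately show ?thesis by simp
  next
    case False
    then have "cbox u v = {}"
      by (metis interval_eq_empty_cart(2) not_le)
    then show ?thesis by simp
  qed
  have "((\<lambda>(s, t). F s t) has_integral integral (cbox (a, c) (b, d)) (\<lambda>(s, t). F s t)) (cbox (a, c) (b, d))"
    using F integrable_continuous by blast
  then have "((\<lambda>v. (\<lambda>(s, t). F s t) (g v)) has_integral (1 / 1) *\<^sub>R integral (cbox (a, c) (b, d)) (\<lambda>(s, t). F s t)) (h ` cbox (a, c) (b, d))"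
    by (rule has_integral_twiddle[rotated 7]) (use gh hg gc hc cont in \<open>auto simp: g_def intro!: continuous_intros\<close>)
  moreover have "integral (cbox (a, c) (b, d)) (\<lambda>(s, t). F s t) = integral {a..b} (\<lambda>s. integral {c..d} (F s))"
    using integral_prod_continuous[OF F] by (simp add: cbox_interval)
  moreover have "h ` cbox (a, c) (b, d) = cbox (vector [a, c]) (vector [b, d])"
    by (simp only: hc) (simp add: h_def)
  ultimately show ?thesis by (simp add: g_def)
qed

lemma det_linear_2:
  fixes f :: "real^2 \<Rightarrow> real^2"
  shows "det (matrix f) = f (axis 1 1) $ 1 * f (axis 2 1) $ 2 - f (axis 2 1) $ 1 * f (axis 1 1) $ 2"
  by (simp add: det_2 matrix_def)


text \<open>Expanding the square and using \<open>|P'|\<^sup>2 \<ge> 2 Re (cnj p * P') - |p|\<^sup>2\<close> leaves a constant plus the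
  real part of a holomorphic function, to which the mean value property applies.\<close>

lemma circle_integral_lower_bound:
  assumes P: "P holomorphic_on ball 0 1" and r: "0 < r" "r < 1"
  defines "D \<equiv> \<lambda>z. deriv P z - 1 / z^2"
  shows "2 * pi * (1 / r^2 + r^2 * (cmod (deriv P 0))^2)
           \<le> integral {0..2*pi} (\<lambda>t. r^2 * (cmod (D (of_real r * cis t)))^2)"
proof -
  define p where "p = deriv P 0"
  have P': "deriv P holomorphic_on ball 0 1"
    using P by (intro holomorphic_deriv) auto
  \<comment> \<open>The first coefficient comes from linearising \<open>|P'|^2\<close> at
    \<open>p\<close>. The second comes from the cross term with \<open>1 / z^2\<close>, which
    becomes holomorphic because \<open>cnj (1 / z^2) = z^2 / r^4\<close> on the circle.\<close>
  define Q where "Q = (\<lambda>z. (of_real (2 * r^2) * cnj p - of_real (2 / r^2) * z^2) * deriv P z)"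
  have "Q holomorphic_on ball 0 1"
    unfolding Q_def by (intro holomorphic_intros P')
  from mean_value_circle[OF this r]
  have "((\<lambda>t. Re (Q (of_real r * cis t))) has_integral Re (of_real (2 * pi) * Q 0)) {0..2*pi}"
    by (rule has_integral_Re)
  moreover have "((\<lambda>t. 1 / r^2 - r^2 * (cmod p)^2) has_integral ((2*pi) * (1 / r^2 - r^2 * (cmod p)^2))) {0..2*pi}"
    using has_integral_const_real[of "1 / r^2 - r^2 * (cmod p)^2" 0 "2*pi"] by simp
  ultimately have "((\<lambda>t. Re (Q (of_real r * cis t)) + (1 / r^2 - r^2 * (cmod p)^2)) has_integral
      (Re (of_real (2 * pi) * Q 0) + (2*pi) * (1 / r^2 - r^2 * (cmod p)^2))) {0..2*pi}"
    by (rule has_integral_add)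
  moreover have "Re (of_real (2 * pi) * Q 0) + (2*pi) * (1 / r^2 - r^2 * (cmod p)^2)
      = 2 * pi * (1 / r^2 + r^2 * (cmod p)^2)"
  proof -
    have "Q 0 = of_real (2 * r^2 * (cmod p)^2)"
      by (simp add: Q_def p_def[symmetric]) (simp add: complex_norm_square of_real_power[symmetric] mult_ac del: of_real_power)
    then show ?thesis by (simp only: of_real_mult[symmetric] Re_complex_of_real) (simp add: algebra_simps)
  qed
  ultimately have low: "((\<lambda>t. Re (Q (of_real r * cis t)) + (1 / r^2 - r^2 * (cmod p)^2)) has_integral
      (2 * pi * (1 / r^2 + r^2 * (cmod p)^2))) {0..2*pi}"
    by simp
  have "continuous_on (ball 0 1 - {0}) D"
    unfolding D_def by (intro continuous_intros holomorphic_on_imp_continuous_on holomorphic_on_subset[OF P']) auto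
  then have "continuous_on {0..2*pi} (\<lambda>t. D (of_real r * cis t))"
    by (rule continuous_on_compose2[of _ D]) (use r in \<open>auto intro!: continuous_intros simp: norm_mult\<close>)
  then have int: "(\<lambda>t. r^2 * (cmod (D (of_real r * cis t)))^2) integrable_on {0..2*pi}"
    by (intro integrable_continuous_real continuous_intros)
  show ?thesis unfolding p_def[symmetric]
  proof (rule has_integral_le[OF low integrable_integral[OF int]])
    fix t
    define z where "z = of_real r * cis t"
    define w where "w = deriv P z"
    have rz: "z * cnj z = of_real (r^2)" and "z \<noteq> 0"
      using r by (auto simp: z_def complex_mult_cnj power2_eq_square cis_cnj mult_ac cis_mult)
    have "1 / z = cnj z / of_real (r^2)"
      using rz r \<open>z \<noteq> 0\<close> by (simp add: field_simps)
    then have "1 / z^2 = (cnj z)^2 / of_real (r^4)"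
      by (metis (no_types, lifting) of_real_power power_divide power_mult power_one mult_2_right numeral_Bit0 )
    then have D: "D z = w - (cnj z)^2 / of_real (r^4)"
      by (simp add: D_def w_def)
    have "of_real (r^2 * (cmod (D z))^2) = of_real (r^2) * ((w - (cnj z)^2 / of_real (r^4)) * (cnj w - z^2 / of_real (r^4)))"
      by (simp only: D of_real_mult complex_norm_square) simp
    also have "\<dots> = of_real (r^2) * w * cnj w - (z^2 * w + cnj (z^2 * w)) / of_real (r^2) + (z * cnj z)^2 / of_real (r^6)"
      using r by (simp add: field_simps eval_nat_numeral)
    also have "\<dots> = of_real (r^2 * (cmod w)^2 - 2 * Re (z^2 * w) / r^2 + 1 / r^2)"
    proof -
      have "(of_real (r^2) :: complex)^2 / of_real (r^6) = of_real (1 / r^2)"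
        using r by (simp add: field_simps eval_nat_numeral)
      then show ?thesis
        unfolding rz complex_add_cnj of_real_add of_real_diff of_real_mult complex_norm_square by simp
    qed
    finally have "r^2 * (cmod (D z))^2 = r^2 * (cmod w)^2 - 2 * Re (z^2 * w) / r^2 + 1 / r^2"
      by (simp only: of_real_eq_iff)
    moreover have "2 * Re (cnj p * w) - (cmod p)^2 \<le> (cmod w)^2"
    proof -
      have "0 \<le> (cmod (w - p))^2" by simp
      also have "\<dots> = (cmod w)^2 - 2 * Re (cnj p * w) + (cmod p)^2"
        unfolding cmod_power2 by (simp add: power2_eq_square algebra_simps)
      finally show ?thesis by simp
    qed
    then have "r^2 * (2 * Re (cnj p * w) - (cmod p)^2) \<le> r^2 * (cmod w)^2"
      by (rule mult_left_mono) simp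
    moreover have "Re (Q z) = r^2 * (2 * Re (cnj p * w)) - 2 * Re (z^2 * w) / r^2"
    proof -
      have "Q z = of_real (r^2 * 2) * (cnj p * w) - of_real (2 / r^2) * (z^2 * w)"
        by (simp add: Q_def w_def algebra_simps)
      then show ?thesis by (simp only: minus_complex.sel Re_complex_of_real times_complex.sel Im_complex_of_real) simp
    qed
    ultimately show "Re (Q (of_real r * cis t)) + (1 / r^2 - r^2 * (cmod p)^2) \<le> r^2 * (cmod (D (of_real r * cis t)))^2"
      unfolding z_def[symmetric] by (simp add: algebra_simps)
  qed
qed

text \<open>The circle bound is integrated over the radii in the variable \<open>s = ln r\<close>,
  in which the area element \<open>r dr dt\<close> becomes \<open>r^2 ds dt\<close>; this is the
  factor \<open>(exp s)^2\<close>. The right-hand primitive is \<open>A\<close> below.\<close>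

lemma annulus_integral_lower_bound:
  assumes P: "P holomorphic_on ball 0 1" and ab: "a < b" "b < 0"
  defines "D \<equiv> \<lambda>z. deriv P z - 1 / z^2"
  shows "continuous_on (cbox (a, 0) (b, 2*pi)) (\<lambda>(s, t). (exp s)^2 * (cmod (D (of_real (exp s) * cis t)))^2)" (is ?cont)
    and "pi * ((1 / (exp a)^2 - 1 / (exp b)^2) + (cmod (deriv P 0))^2 * ((exp b)^2 - (exp a)^2))
      \<le> integral {a..b} (\<lambda>s. integral {0..2*pi} (\<lambda>t. (exp s)^2 * (cmod (D (of_real (exp s) * cis t)))^2))"
proof -
  have P': "deriv P holomorphic_on ball 0 1"
    using P by (intro holomorphic_deriv) auto
  have "continuous_on (ball 0 1 - {0}) D"
    unfolding D_def by (intro continuous_intros holomorphic_on_imp_continuous_on holomorphic_on_subset[OF P']) auto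
  then have "continuous_on (cbox (a, 0) (b, 2*pi)) (\<lambda>x. D (of_real (exp (fst x)) * cis (snd x)))"
    by (rule continuous_on_compose2[of _ D]) (use ab in \<open>auto intro!: continuous_intros simp: norm_mult\<close>)
  then have c: "continuous_on (cbox (a, 0) (b, 2*pi)) (\<lambda>x. (exp (fst x))^2 * (cmod (D (of_real (exp (fst x)) * cis (snd x))))^2)"
    by (intro continuous_intros)
  then show ?cont by (simp add: case_prod_unfold)
  have int: "(\<lambda>s. integral {0..2*pi} (\<lambda>t. (exp s)^2 * (cmod (D (of_real (exp s) * cis t)))^2)) integrable_on {a..b}"
    using integral_integrable_2dim[OF \<open>?cont\<close>] by (simp add: cbox_interval)
  define p where "p = (cmod (deriv P 0))^2"
  define A where "A = (\<lambda>s. pi * (p * (exp s)^2 - 1 / (exp s)^2))"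
  have "((\<lambda>s. 2 * pi * (1 / (exp s)^2 + (exp s)^2 * p)) has_integral (A b - A a)) {a..b}"
  proof (rule fundamental_theorem_of_calculus)
    show "(A has_vector_derivative 2 * pi * (1 / (exp x)^2 + (exp x)^2 * p)) (at x within {a..b})" for x
      unfolding A_def has_real_derivative_iff_has_vector_derivative[symmetric]
      by (auto intro!: derivative_eq_intros simp: field_simps power2_eq_square)
  qed (use ab in auto)
  then have "A b - A a \<le> integral {a..b} (\<lambda>s. integral {0..2*pi} (\<lambda>t. (exp s)^2 * (cmod (D (of_real (exp s) * cis t)))^2))"
  proof (rule has_integral_le[OF _ integrable_integral[OF int]])
    fix s assume "s \<in> {a..b}"
    then have "exp s < 1" using ab by auto
    then show "2 * pi * (1 / (exp s)^2 + (exp s)^2 * p) \<le> integral {0..2*pi} (\<lambda>t. (exp s)^2 * (cmod (D (of_real (exp s) * cis t)))^2)"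
      unfolding p_def D_def using circle_integral_lower_bound[OF P, of "exp s"] by simp
  qed
  then show "pi * ((1 / (exp a)^2 - 1 / (exp b)^2) + (cmod (deriv P 0))^2 * ((exp b)^2 - (exp a)^2))
      \<le> integral {a..b} (\<lambda>s. integral {0..2*pi} (\<lambda>t. (exp s)^2 * (cmod (D (of_real (exp s) * cis t)))^2))"
    by (simp add: A_def p_def algebra_simps)
qed

section \<open>The ellipse around the image of a small circle\<close>

text \<open>
  On \<open>|z| = e\<close> the function \<open>1/z + p z\<close> equals \<open>\<zeta> + p e\<^sup>2 cnj \<zeta>\<close> with \<open>\<zeta> = 1/z\<close>, so the image of the
  circle is an ellipse up to an error \<open>O(e\<^sup>2)\<close>.  The map below with \<open>q = p e\<^sup>2\<close> straightens this
  ellipse to a circle; comparing areas with the ellipse instead of a disc is what makes the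
  constant in the area theorem sharp.
\<close>

definition ellipse_map :: "complex \<Rightarrow> complex \<Rightarrow> complex" where
  "ellipse_map q w = w - q * cnj w"

lemma ellipse_map_linear: "linear (ellipse_map q)"
  by (rule linearI) (auto simp: ellipse_map_def algebra_simps)

lemma ellipse_map_add: "ellipse_map q (v + w) = ellipse_map q v + ellipse_map q w"
  by (auto simp: ellipse_map_def algebra_simps)

lemma norm_ellipse_map_ge: "(1 - cmod q) * cmod w \<le> cmod (ellipse_map q w)"
  using norm_triangle_ineq2[of w "q * cnj w"] by (simp add: ellipse_map_def norm_mult algebra_simps)

lemma norm_ellipse_map_le: "cmod (ellipse_map q w) \<le> (1 + cmod q) * cmod w"
  using norm_triangle_ineq4[of w "q * cnj w"] by (simp add: ellipse_map_def norm_mult algebra_simps)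

lemma bij_ellipse_map:
  assumes "cmod q < 1"
  shows "bij (ellipse_map q)"
proof -
  have "inj (ellipse_map q)"
    unfolding linear_injective_0[OF ellipse_map_linear]
    using norm_ellipse_map_ge[of q] assms
    by (metis diff_gt_0_iff_gt linorder_not_le mult_le_0_iff norm_le_zero_iff norm_zero)
  then show ?thesis
    using linear_injective_imp_surjective[OF ellipse_map_linear] by (auto simp: bij_def)
qed

lemma continuous_on_ellipse_map [continuous_intros]:
  "continuous_on S f \<Longrightarrow> continuous_on S (\<lambda>x. ellipse_map q (f x))"
  unfolding ellipse_map_def by (intro continuous_intros)

text \<open>The covered part of the exterior is open by the open mapping theorem and relatively closed
  because the boundary circle stays inside \<open>cball 0 R\<close>; the exterior is connected.\<close>

lemma pole_image_covers_exterior: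
  assumes P: "P holomorphic_on ball 0 1"
    and inj: "inj_on (\<lambda>z. 1 / z + P z) (ball 0 1 - {0})"
    and q: "cmod q < 1" and e: "0 < e" "e < 1"
    and R: "\<And>z. cmod z = e \<Longrightarrow> cmod (ellipse_map q (1 / z + P z)) \<le> R"
    and w: "R < cmod w"
  obtains z where "0 < cmod z" "cmod z < e" "ellipse_map q (1 / z + P z) = w"
proof -
  define H where "H = (\<lambda>z. ellipse_map q (1 / z + P z))"
  define U where "U = - cball (0::complex) R"
  define V where "V = H ` (ball 0 e - {0}) \<inter> U"
  have holG: "(\<lambda>z. 1 / z + P z) holomorphic_on (ball 0 e - {0})"
    using e by (intro holomorphic_intros holomorphic_on_subset[OF P]) auto
  have contH: "continuous_on (cball 0 e - {0}) H"
    unfolding H_def using e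
    by (intro continuous_intros continuous_on_subset[OF holomorphic_on_imp_continuous_on[OF P]]) auto
  have "open ((\<lambda>z. 1 / z + P z) ` (ball 0 e - {0}))"
    by (rule open_mapping_thm3[OF holG]) (use e in \<open>auto intro!: inj_on_subset[OF inj]\<close>)
  then have "open (ellipse_map q ` (\<lambda>z. 1 / z + P z) ` (ball 0 e - {0}))"
    by (rule open_surjective_linear_image) (use bij_ellipse_map[OF q] ellipse_map_linear in \<open>auto simp: bij_def\<close>)
  then have opV: "open V"
    by (auto simp: V_def U_def H_def image_image intro!: open_Int)
  have "compact (P ` cball 0 e)"
    using e by (intro compact_continuous_image continuous_on_subset[OF holomorphic_on_imp_continuous_on[OF P]]) auto
  then obtain M where M: "0 < M" "\<And>z. cmod z \<le> e \<Longrightarrow> cmod (P z) \<le> M"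
    using compact_imp_bounded bounded_pos by (metis image_eqI mem_cball_0)
  \<comment> \<open>The pole dominates near 0. With \<open>L = R\<close> this makes \<open>V\<close>
    nonempty. With \<open>L = cmod v + 1\<close> it keeps preimages of points near \<open>v\<close>
    away from the pole, so that only a compact annulus matters for closedness.\<close>
  have big: "\<exists>d. 0 < d \<and> d < e \<and> (\<forall>z. 0 < cmod z \<and> cmod z \<le> d \<longrightarrow> L < cmod (H z))" for L
  proof -
    define d where "d = min (e / 2) (1 / (M + (\<bar>L\<bar> + 1) / (1 - cmod q)))"
    have pos: "0 < M + (\<bar>L\<bar> + 1) / (1 - cmod q)"
      using M q by (auto intro!: add_pos_nonneg)
    then have d: "0 < d" "d < e" using e by (auto simp: d_def min_def)
    moreover have "L < cmod (H z)" if z: "0 < cmod z" "cmod z \<le> d" for z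
    proof -
      have "cmod z \<le> 1 / (M + (\<bar>L\<bar> + 1) / (1 - cmod q))" using z by (simp add: d_def)
      then have "M + (\<bar>L\<bar> + 1) / (1 - cmod q) \<le> 1 / cmod z"
        using pos z by (simp add: field_simps)
      also have "\<dots> = cmod (1 / z)" by (simp add: norm_divide)
      also have "\<dots> \<le> cmod (1 / z + P z) + M"
        using norm_triangle_ineq4[of "1 / z + P z" "P z"] M(2)[of z] z d by auto
      finally have "(\<bar>L\<bar> + 1) / (1 - cmod q) \<le> cmod (1 / z + P z)" by simp
      then have "\<bar>L\<bar> + 1 \<le> (1 - cmod q) * cmod (1 / z + P z)"
        using q by (simp add: field_simps)
      also have "\<dots> \<le> cmod (H z)" unfolding H_def by (rule norm_ellipse_map_ge)
      finally show ?thesis by linarith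
    qed
    ultimately show ?thesis by blast
  qed
  have "V \<noteq> {}"
  proof -
    obtain d where d: "0 < d" "d < e" "\<And>z. 0 < cmod z \<and> cmod z \<le> d \<longrightarrow> R < cmod (H z)"
      using big by blast
    then have "R < cmod (H (of_real d))" by simp
    moreover have "of_real d \<in> ball 0 e - {0::complex}" using d by simp
    ultimately have "H (of_real d) \<in> V"
      unfolding V_def U_def by simp
    then show ?thesis by blast
  qed
  have "v \<in> V" if v: "v \<in> U" "v \<in> closure V" for v
  proof -
    obtain d where d: "0 < d" "d < e" "\<And>z. 0 < cmod z \<and> cmod z \<le> d \<longrightarrow> cmod v + 1 < cmod (H z)"
      using big by blast
    define C where "C = H ` (cball 0 e - ball 0 d)"
    have "compact C" unfolding C_def
      by (intro compact_continuous_image continuous_on_subset[OF contH] compact_diff)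
         (use d in auto)
    have "v \<in> closure (ball v 1 \<inter> V)"
      using v open_Int_closure_subset[of "ball v 1" V] by auto
    also have "\<dots> \<subseteq> C"
    proof (rule closure_minimal)
      show "closed C" using \<open>compact C\<close> compact_imp_closed by blast
      show "ball v 1 \<inter> V \<subseteq> C"
      proof
        fix x assume x: "x \<in> ball v 1 \<inter> V"
        then obtain z where z: "x = H z" "cmod z < e" "z \<noteq> 0" unfolding V_def by fastforce
        have "cmod x < cmod v + 1"
          using x norm_triangle_ineq2[of x v] by (auto simp: dist_norm norm_minus_commute)
        then have "\<not> cmod z < d" using d(3)[of z] z by auto
        then show "x \<in> C" using z by (auto simp: C_def)
      qed
    qed
    finally obtain z where z: "v = H z" "cmod z \<le> e" "d \<le> cmod z" by (auto simp: C_def)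
    moreover have "cmod z \<noteq> e" using R[of z] v z by (auto simp: U_def H_def)
    ultimately show "v \<in> V" using v d by (auto simp: V_def intro!: imageI)
  qed
  then have "V = closure V \<inter> U"
    using closure_subset[of V] by (auto simp: V_def)
  then have "closedin (top_of_set U) V"
    by (metis closed_closure closedin_closed_Int inf_commute)
  moreover have "openin (top_of_set U) V"
    using opV by (simp add: open_subset V_def)
  moreover have "connected U"
    unfolding U_def by (rule connected_complement_bounded_convex) auto
  ultimately have "V = U" using \<open>V \<noteq> {}\<close> by (meson connected_clopen)
  then have "w \<in> V" using w by (auto simp: U_def)
  then obtain z where "z \<in> ball 0 e - {0}" "w = H z" unfolding V_def by blast
  then show ?thesis
    using that[of z] by (simp add: H_def)
qed

text \<open>The library's change of variables formula is only available on \<open>real^'n\<close>.\<close>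

definition complex_of_vec :: "real^2 \<Rightarrow> complex" where
  "complex_of_vec v = Complex (v$1) (v$2)"

definition vec_of_complex :: "complex \<Rightarrow> real^2" where
  "vec_of_complex z = vector [Re z, Im z]"

lemma bounded_linear_complex_of_vec: "bounded_linear complex_of_vec"
  by (rule linear_conv_bounded_linear[THEN iffD1], rule linearI)
     (auto simp: complex_of_vec_def complex_eq_iff)

lemma bounded_linear_vec_of_complex: "bounded_linear vec_of_complex"
  by (rule linear_conv_bounded_linear[THEN iffD1], rule linearI)
     (auto simp: vec_of_complex_def vec_eq_iff forall_2)

lemma norm_vec_of_complex: "norm (vec_of_complex z) = cmod z"
  by (simp add: vec_of_complex_def norm_vec_def L2_set_def sum_2 cmod_def)

lemma inj_vec_of_complex: "inj vec_of_complex"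
  by (rule injI) (simp add: vec_of_complex_def vec_eq_iff forall_2 complex_eq_iff)

section \<open>Area of the image of an annulus\<close>

text \<open>In logarithmic polar coordinates the map becomes an injective \<open>f\<close> on a box,
  with image inside \<open>cball 0 R\<close>. Its Jacobian is \<open>1 - |q|^2\<close>, the
  determinant of \<open>ellipse_map q\<close>, times the squared modulus of a complex derivative,
  whose integral is already bounded below.\<close>

lemma area_annulus_le:
  assumes P: "P holomorphic_on ball 0 1"
    and inj: "inj_on (\<lambda>z. 1 / z + P z) (ball 0 1 - {0})"
    and q: "cmod q < 1" and e: "0 < e" "e < d" "d < 1"
    and R: "\<And>z. e < cmod z \<Longrightarrow> cmod z < d \<Longrightarrow> cmod (ellipse_map q (1 / z + P z)) \<le> R"
  shows "(1 - (cmod q)^2) * (1 / e^2 - 1 / d^2 + (cmod (deriv P 0))^2 * (d^2 - e^2)) \<le> R^2"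
proof -
  define a b where "a = ln e" and "b = ln d"
  have ab: "a < b" "b < 0" "exp a = e" "exp b = d" using e by (auto simp: a_def b_def)
  define D where "D = (\<lambda>z. deriv P z - 1 / z^2)"
  \<comment> \<open>The open box leaves out the ray of angle 0, so that \<open>exp\<close> is
    injective on it; passing from the closed box to the open one does not change the
    integral.\<close>
  define S where "S = box (vector [a, 0]) (vector [b, 2*pi] :: real^2)"
  define T where "T = (\<lambda>v. exp (complex_of_vec v))"
  define f where "f = (\<lambda>v. vec_of_complex (ellipse_map q (1 / T v + P (T v))))"
  define E where "E = (\<lambda>v. D (T v) * T v)"
  define f' where "f' = (\<lambda>v u. vec_of_complex (ellipse_map q (E v * complex_of_vec u)))"
  define F where "F = (\<lambda>s t. (exp s)^2 * (cmod (D (of_real (exp s) * cis t)))^2)"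
  have S: "v \<in> S \<longleftrightarrow> a < v$1 \<and> v$1 < b \<and> 0 < v$2 \<and> v$2 < 2 * pi" for v
    by (auto simp: S_def mem_box_cart forall_2)
  have T: "T v = of_real (exp (v$1)) * cis (v$2)" for v
    by (simp add: T_def complex_of_vec_def exp_eq_polar)
  have normT: "cmod (T v) = exp (v$1)" for v
    by (simp add: T norm_mult)
  have TS: "e < cmod (T v)" "cmod (T v) < d" if "v \<in> S" for v
    using that ab unfolding normT S by (metis exp_less_mono)+
  have der: "(f has_derivative f' v) (at v within S)" if v: "v \<in> S" for v
  proof -
    have nz: "T v \<noteq> 0" by (simp add: T_def)
    have "P field_differentiable at (T v)"
      using TS[OF v] e by (intro holomorphic_on_imp_differentiable_at[OF P]) auto
    then have "(P has_field_derivative deriv P (T v)) (at (T v))"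
      by (simp add: DERIV_deriv_iff_field_differentiable)
    then have "((\<lambda>z. 1 / z + P z) has_field_derivative D (T v)) (at (T v))"
      unfolding D_def using nz by (auto intro!: derivative_eq_intros simp: power2_eq_square)
    moreover have "T = (\<lambda>v. exp (complex_of_vec v))" by (simp add: T_def)
    moreover have "(exp has_field_derivative T v) (at (complex_of_vec v))"
      by (simp add: T_def DERIV_exp)
    ultimately have "((\<lambda>z. 1 / exp z + P (exp z)) has_field_derivative E v) (at (complex_of_vec v))"
      unfolding E_def by (intro DERIV_chain2[of "\<lambda>z. 1 / z + P z" _ exp]) auto
    then have 1: "((\<lambda>z. 1 / exp z + P (exp z)) has_derivative (\<lambda>h. E v * h)) (at (complex_of_vec v))"
      by (simp add: has_field_derivative_def)
    have 2: "(complex_of_vec has_derivative complex_of_vec) (at v within S)"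
      by (rule bounded_linear_imp_has_derivative[OF bounded_linear_complex_of_vec])
    have "bounded_linear (\<lambda>w. vec_of_complex (ellipse_map q w))"
      by (intro bounded_linear_compose[OF bounded_linear_vec_of_complex])
         (simp add: ellipse_map_linear linear_conv_bounded_linear[symmetric])
    from bounded_linear.has_derivative[OF this has_derivative_compose[OF 2 1]]
    show ?thesis unfolding f_def f'_def T_def .
  qed
  have injf: "inj_on f S"
  proof (rule inj_onI)
    fix v w assume v: "v \<in> S" and w: "w \<in> S" and eq: "f v = f w"
    then have "ellipse_map q (1 / T v + P (T v)) = ellipse_map q (1 / T w + P (T w))"
      using inj_vec_of_complex by (simp add: f_def inj_eq)
    then have "1 / T v + P (T v) = 1 / T w + P (T w)"
      using bij_ellipse_map[OF q] by (simp add: bij_def inj_eq)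
    then have "T v = T w"
      by (rule inj_onD[OF inj]) (use TS[OF v] TS[OF w] e in auto)
    then have n: "v$1 = w$1" using normT by (metis exp_inj_iff)
    with \<open>T v = T w\<close> have "cis (v$2) = cis (w$2)" by (simp add: T)
    moreover have "Arg2pi (cis (u$2)) = u$2" if "u \<in> S" for u :: "real^2"
      using that unfolding S by (intro Arg2pi_unique[of 1]) (auto simp: cis_conv_exp)
    ultimately have "v$2 = w$2" using v w by metis
    with n show "v = w" by (simp add: vec_eq_iff forall_2)
  qed
  have det: "\<bar>det (matrix (f' v))\<bar> = (1 - (cmod q)^2) * F (v$1) (v$2)" for v
  proof -
    have [simp]: "complex_of_vec (axis 1 1) = 1" "complex_of_vec (axis 2 1) = \<i>"
      by (auto simp: complex_of_vec_def axis_def complex_eq_iff)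
    have "det (matrix (f' v)) = (1 - (cmod q)^2) * (cmod (E v))^2"
      unfolding det_linear_2 f'_def cmod_power2
      by (simp add: vec_of_complex_def ellipse_map_def power2_eq_square algebra_simps)
    also have "(cmod (E v))^2 = F (v$1) (v$2)"
      by (simp add: E_def norm_mult normT F_def power_mult_distrib mult_ac T)
    finally show ?thesis
      using q by (simp add: F_def power_le_one abs_mult)
  qed
  define J where "J = integral {a..b} (\<lambda>s. integral {0..2 * pi} (F s))"
  have cont: "continuous_on (cbox (a, 0) (b, 2 * pi)) (\<lambda>(s, t). F s t)"
    using annulus_integral_lower_bound(1)[OF P ab(1,2)] unfolding F_def D_def .
  have lb: "pi * (1 / e^2 - 1 / d^2 + (cmod (deriv P 0))^2 * (d^2 - e^2)) \<le> J"
    using annulus_integral_lower_bound(2)[OF P ab(1,2)] unfolding J_def F_def D_def ab .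
  have "((\<lambda>v. (1 - (cmod q)^2) * F (v$1) (v$2)) has_integral (1 - (cmod q)^2) * J) S"
    unfolding S_def J_def has_integral_open_interval
    by (intro has_integral_mult_right integral_real2 cont)
  then have "((\<lambda>v. \<bar>det (matrix (f' v))\<bar>) has_integral (1 - (cmod q)^2) * J) S"
    by (simp only: det)
  then have "f ` S \<in> lmeasurable \<and> measure lebesgue (f ` S) = (1 - (cmod q)^2) * J"
    by (subst has_measure_differentiable_image[OF _ der injf]) (auto simp: S_def)
  moreover have "f ` S \<subseteq> cball 0 R"
    using R[OF TS] by (auto simp: f_def norm_vec_of_complex)
  moreover have "0 \<le> R"
  proof -
    have "cmod (ellipse_map q (1 / of_real ((e + d) / 2) + P (of_real ((e + d) / 2)))) \<le> R"
      using e by (intro R) (auto simp: norm_of_real simp del: of_real_add of_real_divide)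
    then show ?thesis by (rule order_trans[OF norm_ge_zero])
  qed
  moreover have "measure lebesgue (cball (0::real^2) R) = pi * R^2"
    using content_cball[OF \<open>0 \<le> R\<close>, of "0::real^2"] by (simp add: unit_ball_vol_2)
  ultimately have "(1 - (cmod q)^2) * J \<le> pi * R^2"
    by (metis lmeasurable_cball measure_mono_fmeasurable fmeasurableD)
  moreover have "(1 - (cmod q)^2) * (pi * (1 / e^2 - 1 / d^2 + (cmod (deriv P 0))^2 * (d^2 - e^2))) \<le> (1 - (cmod q)^2) * J"
    using lb q by (intro mult_left_mono) (auto simp: power_le_one)
  ultimately have "pi * ((1 - (cmod q)^2) * (1 / e^2 - 1 / d^2 + (cmod (deriv P 0))^2 * (d^2 - e^2))) \<le> pi * R^2"
    by (simp add: algebra_simps)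
  then show ?thesis by simp
qed

section \<open>The sharp bound on the first coefficient\<close>

lemma holomorphic_factor_at_0:
  assumes "f holomorphic_on S" "open S" "f 0 = 0"
  obtains g where "g holomorphic_on S" "\<And>z. f z = z * g z" "g 0 = deriv f 0"
proof
  show "(\<lambda>z. if z = 0 then deriv f 0 else f z / z) holomorphic_on S"
    by (rule pole_theorem_open_0[OF assms(1,2), where a = 0]) (use assms in auto)
qed (use assms in auto)

text \<open>Comparing with a disc (\<open>q = 0\<close>) would bound the circle
  \<open>|z| = e\<close> only by \<open>1 / e + |p| e\<close> up to \<open>O(e^2)\<close>. Its
  square leaves \<open>2 |p|\<close> in the limit, which yields no more than
  \<open>|p| \<le> 1 + sqrt 2\<close>. With \<open>q = p e^2\<close> the error is
  \<open>O(e^2)\<close>, and letting \<open>e\<close> tend to 0 and then \<open>d\<close> to 1 gives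
  \<open>|p|^2 \<le> 1\<close>.\<close>

theorem area_theorem:
  assumes P: "P holomorphic_on ball 0 1"
    and inj: "inj_on (\<lambda>z. 1 / z + P z) (ball 0 1 - {0})"
  shows "cmod (deriv P 0) \<le> 1"
proof -
  define p where "p = deriv P 0"
  \<comment> \<open>A constant term \<open>a\<close> would enter the squared radius as
    \<open>2 |a| / e\<close>, which diverges; translating the image removes it.\<close>
  define P0 where "P0 = (\<lambda>z. P z - P 0)"
  have P0: "P0 holomorphic_on ball 0 1" "P0 0 = 0"
    unfolding P0_def by (auto intro!: holomorphic_intros P)
  have dP0: "deriv P0 0 = p"
  proof -
    have "P field_differentiable at 0"
      by (intro holomorphic_on_imp_differentiable_at[OF P]) auto
    then show ?thesis unfolding P0_def p_def by (subst deriv_diff) auto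
  qed
  have inj0: "inj_on (\<lambda>z. 1 / z + P0 z) (ball 0 1 - {0})"
    using inj by (auto simp: inj_on_def P0_def)
  obtain P1 where P1: "P1 holomorphic_on ball 0 1" "\<And>z. P0 z = z * P1 z" "P1 0 = p"
    using holomorphic_factor_at_0[OF P0(1) open_ball P0(2)] unfolding dP0 by blast
  obtain P2 where P2: "P2 holomorphic_on ball 0 1" "\<And>z. P1 z - p = z * P2 z"
  proof (rule holomorphic_factor_at_0)
    show "(\<lambda>z. P1 z - p) holomorphic_on ball 0 1" by (intro holomorphic_intros P1)
  qed (use P1 in auto)
  have P0_eq: "P0 z = p * z + z^2 * P2 z" for z
    using P1(2)[of z] P2(2)[of z] by (simp add: algebra_simps power2_eq_square)
  have "compact (P2 ` cball 0 (1/2))"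
    by (intro compact_continuous_image continuous_on_subset[OF holomorphic_on_imp_continuous_on[OF P2(1)]]) auto
  then obtain C where C: "0 < C" "\<And>z. cmod z \<le> 1/2 \<Longrightarrow> cmod (P2 z) \<le> C"
    using compact_imp_bounded bounded_pos by (metis image_eqI mem_cball_0)
  \<comment> \<open>\<open>2 * C\<close> bounds the remainder \<open>z^2 * P2 z\<close> after
    \<open>ellipse_map q\<close>, where \<open>1 + |q| \<le> 2\<close>. The summand
    \<open>(cmod p)^2\<close> covers the residue of order \<open>e^3\<close> that is left of the
    straightened ellipse.\<close>
  define K where "K = 2 * C + (cmod p)^2"
  have bound: "(1 - (cmod p)^2 * e^4) * (1 / e^2 - 1 / d^2 + (cmod p)^2 * (d^2 - e^2)) \<le> (1 / e + K * e^2)^2"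
    if e: "0 < e" "e < 1/2" "e < d" "d < 1" "cmod p * e^2 < 1" for e d
  proof -
    define q where "q = p * of_real (e^2)"
    have q: "cmod q = cmod p * e^2" by (simp add: q_def norm_mult norm_power)
    have R: "cmod (ellipse_map q (1 / z + P0 z)) \<le> 1 / e + K * e^2" if z: "cmod z = e" for z
    proof -
      have zz: "z * cnj z = of_real (e^2)" and nz: "z \<noteq> 0"
        using z e by (auto simp: complex_norm_square[symmetric])
      then have "of_real (e^2) * cnj (1 / z) = z"
        by (simp add: field_simps)
      then have "ellipse_map q (1 / z + p * z) = 1 / z - p * of_real (e^2) * cnj p * cnj z"
        by (simp add: ellipse_map_def q_def algebra_simps)
      then have "cmod (ellipse_map q (1 / z + p * z)) \<le> cmod (1 / z) + cmod (p * of_real (e^2) * cnj p * cnj z)"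
        using norm_triangle_ineq4 by metis
      also have "\<dots> = 1 / e + (cmod p)^2 * e^3"
        using z by (simp add: norm_mult norm_divide norm_power power2_eq_square eval_nat_numeral mult_ac)
      also have "(cmod p)^2 * e^3 \<le> (cmod p)^2 * e^2"
        using e by (intro mult_left_mono power_decreasing) auto
      finally have 1: "cmod (ellipse_map q (1 / z + p * z)) \<le> 1 / e + (cmod p)^2 * e^2" by simp
      have "cmod (ellipse_map q (z^2 * P2 z)) \<le> (1 + cmod q) * cmod (z^2 * P2 z)"
        by (rule norm_ellipse_map_le)
      also have "\<dots> \<le> 2 * (e^2 * C)"
        using z C(2)[of z] e q by (intro mult_mono) (auto simp: norm_mult norm_power intro!: mult_left_mono)
      finally have 2: "cmod (ellipse_map q (z^2 * P2 z)) \<le> 2 * (e^2 * C)" .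
      have "1 / z + P0 z = (1 / z + p * z) + z^2 * P2 z" by (simp add: P0_eq)
      then have "ellipse_map q (1 / z + P0 z) = ellipse_map q (1 / z + p * z) + ellipse_map q (z^2 * P2 z)"
        by (simp only: ellipse_map_add)
      then have "cmod (ellipse_map q (1 / z + P0 z)) \<le> cmod (ellipse_map q (1 / z + p * z)) + cmod (ellipse_map q (z^2 * P2 z))"
        using norm_triangle_ineq by metis
      then show ?thesis using 1 2 by (simp add: K_def algebra_simps)
    qed
    \<comment> \<open>A value beyond the radius is already taken at some \<open>w\<close> with
      \<open>|w| < e\<close>, which contradicts injectivity. So the whole annulus is mapped
      inside.\<close>
    have "cmod (ellipse_map q (1 / z + P0 z)) \<le> 1 / e + K * e^2" if z: "e < cmod z" "cmod z < d" for z
    proof (rule ccontr)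
      assume "\<not> ?thesis"
      then obtain w where w: "0 < cmod w" "cmod w < e" "ellipse_map q (1 / w + P0 w) = ellipse_map q (1 / z + P0 z)"
        using pole_image_covers_exterior[OF P0(1) inj0, of q e "1 / e + K * e^2" "ellipse_map q (1 / z + P0 z)"] R q e
        by auto
      then have "1 / w + P0 w = 1 / z + P0 z"
        using bij_ellipse_map[of q] q e by (simp add: bij_def inj_eq)
      then have "w = z"
        by (rule inj_onD[OF inj0]) (use w z e in auto)
      then show False using w z by simp
    qed
    from area_annulus_le[OF P0(1) inj0 _ e(1,3,4) this]
    have "(1 - (cmod q)^2) * (1 / e^2 - 1 / d^2 + (cmod p)^2 * (d^2 - e^2)) \<le> (1 / e + K * e^2)^2"
      using e q dP0 by auto
    moreover have "(cmod q)^2 = (cmod p)^2 * e^4"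
      by (simp add: q power_mult_distrib flip: power_mult)
    ultimately show ?thesis by simp
  qed
  have d_bound: "(cmod p)^2 * d^2 - 1 / d^2 \<le> 0" if d: "0 < d" "d < 1" for d
  proof -
    \<comment> \<open>\<open>L\<close> and \<open>U\<close> are the two sides of
      \<open>bound\<close> minus the divergent \<open>1 / e^2\<close>. Both are continuous at
      \<open>e = 0\<close>, and \<open>U 0 = 0\<close>.\<close>
    define L where "L = (\<lambda>e. (1 - (cmod p)^2 * e^4) * ((cmod p)^2 * (d^2 - e^2) - 1 / d^2) - (cmod p)^2 * e^2)"
    define U where "U = (\<lambda>e. 2 * K * e + K^2 * e^4)"
    have "(L \<longlongrightarrow> L 0) (at_right 0)" "(U \<longlongrightarrow> U 0) (at_right 0)"
      unfolding L_def U_def by (auto intro!: tendsto_eq_intros)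
    moreover have "\<forall>\<^sub>F e in at_right 0. L e \<le> U e"
    proof -
      have "((\<lambda>e. cmod p * e^2) \<longlongrightarrow> 0) (at_right (0::real))"
        by (auto intro!: tendsto_eq_intros)
      then have "\<forall>\<^sub>F e in at_right (0::real). cmod p * e^2 < 1"
        by (rule order_tendstoD) simp
      moreover have "\<forall>\<^sub>F e in at_right (0::real). e \<in> {0<..<min (1/2) d}"
        by (rule eventually_at_right_real) (use d in auto)
      ultimately show ?thesis
      proof eventually_elim
        case (elim e)
        then have "(1 - (cmod p)^2 * e^4) * (1 / e^2 - 1 / d^2 + (cmod p)^2 * (d^2 - e^2)) \<le> (1 / e + K * e^2)^2"
          using d by (intro bound) auto
        moreover have "(1 - (cmod p)^2 * e^4) * (1 / e^2 - 1 / d^2 + (cmod p)^2 * (d^2 - e^2)) = L e + 1 / e^2"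
          using elim d by (simp add: L_def field_simps eval_nat_numeral)
        moreover have "(1 / e + K * e^2)^2 = U e + 1 / e^2"
          using elim by (simp add: U_def field_simps eval_nat_numeral)
        ultimately show ?case by simp
      qed
    qed
    ultimately have "L 0 \<le> U 0"
      using tendsto_le[of "at_right (0::real)" U "U 0" L "L 0"] by simp
    then show ?thesis by (simp add: L_def U_def)
  qed
  have "((\<lambda>d::real. (cmod p)^2 * d^2 - 1 / d^2) \<longlongrightarrow> (cmod p)^2 * 1^2 - 1 / 1^2) (at_left 1)"
    by (intro tendsto_intros) auto
  moreover have "\<forall>\<^sub>F d::real in at_left 1. (cmod p)^2 * d^2 - 1 / d^2 \<le> 0"
    using eventually_at_left_real[of 0 "1::real"] by (auto elim!: eventually_mono dest: d_bound)
  ultimately have "(cmod p)^2 * 1^2 - 1 / 1^2 \<le> 0"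
    by (rule tendsto_upperbound) auto
  then have "(cmod p)^2 \<le> 1^2" by simp
  then show ?thesis unfolding p_def by (rule power2_le_imp_le) simp
qed

section \<open>Bieberbach inequality and Koebe distortion\<close>

text \<open>\<open>s\<close> is a branch of the square root of \<open>\<phi> z / z\<close>, which
  has no zero because \<open>\<phi>\<close> is injective. The odd square root transform of
  \<open>\<phi>\<close> is then \<open>z * s (z^2)\<close>.\<close>

lemma class_S_has_root_transform:
  assumes "\<phi> \<in> class_S"
  obtains s where "s holomorphic_on unit_disk" "\<And>z. z \<in> unit_disk \<Longrightarrow> s z \<noteq> 0" "s 0 = 1"
    "\<And>z. z \<in> unit_disk \<Longrightarrow> \<phi> z = z * (s z)^2" "deriv (deriv \<phi>) 0 = 4 * deriv s 0"
proof -
  have \<phi>: "\<phi> holomorphic_on unit_disk" "inj_on \<phi> unit_disk" "\<phi> 0 = 0" "deriv \<phi> 0 = 1"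
    using assms by (auto simp: class_S_def)
  obtain u where u: "u holomorphic_on unit_disk" "\<And>z. \<phi> z = z * u z" "u 0 = 1"
    using holomorphic_factor_at_0[OF \<phi>(1) open_ball \<phi>(3)] unfolding \<phi>(4) by blast
  have "u z \<noteq> 0" if "z \<in> unit_disk" for z
  proof
    assume "u z = 0"
    then have "\<phi> z = \<phi> 0" using u(2)[of z] \<phi> by simp
    then have "z = 0" by (rule inj_onD[OF \<phi>(2) _ that]) simp
    then show False using \<open>u z = 0\<close> u(3) by simp
  qed
  then obtain s1 where s1: "s1 holomorphic_on unit_disk" "\<And>z. z \<in> unit_disk \<Longrightarrow> u z = (s1 z)^2"
    using contractible_imp_holomorphic_sqrt[OF u(1) convex_imp_contractible[OF convex_ball]] by metis
  \<comment> \<open>\<open>s1 0\<close> is 1 or -1, so this factor fixes the sign of the branch and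
    leaves its square unchanged.\<close>
  define s where "s = (\<lambda>z. s1 0 * s1 z)"
  have s10: "(s1 0)^2 = 1" using s1(2)[of 0] u(3) by simp
  have sq: "u z = (s z)^2" if "z \<in> unit_disk" for z
    using s1(2)[OF that] s10 by (simp add: s_def power_mult_distrib)
  have s: "s holomorphic_on unit_disk" unfolding s_def by (intro holomorphic_intros s1)
  have s0: "s 0 = 1" using s10 by (simp add: s_def power2_eq_square)
  have ds: "(s has_field_derivative deriv s z) (at z)" if "z \<in> unit_disk" for z
    using holomorphic_derivI[OF s open_ball that] .
  have d\<phi>: "deriv \<phi> z = (s z)^2 + z * (2 * s z * deriv s z)" if z: "z \<in> unit_disk" for z
  proof -
    have "((\<lambda>z. z * (s z)^2) has_field_derivative ((s z)^2 + z * (2 * s z * deriv s z))) (at z)"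
      using ds[OF z] by (auto intro!: derivative_eq_intros)
    then have "(\<phi> has_field_derivative ((s z)^2 + z * (2 * s z * deriv s z))) (at z)"
      by (rule has_field_derivative_transform_within_open[OF _ open_ball z]) (simp add: u(2) sq)
    then show ?thesis by (rule DERIV_imp_deriv)
  qed
  have "((\<lambda>z. (s z)^2 + z * (2 * s z * deriv s z)) has_field_derivative 4 * deriv s 0) (at 0)"
  proof -
    have "deriv s holomorphic_on unit_disk" using s by (intro holomorphic_deriv) auto
    then have "(deriv s has_field_derivative deriv (deriv s) 0) (at 0)"
      by (rule holomorphic_derivI[OF _ open_ball]) simp
    with ds[of 0] show ?thesis by (auto intro!: derivative_eq_intros simp: s0)
  qed
  then have "(deriv \<phi> has_field_derivative 4 * deriv s 0) (at 0)"
    by (rule has_field_derivative_transform_within_open[OF _ open_ball[of 0 1]]) (auto simp: d\<phi>)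
  then have "deriv (deriv \<phi>) 0 = 4 * deriv s 0" by (rule DERIV_imp_deriv)
  then show ?thesis
    using s s0 u(2) sq u(3) \<open>\<And>z. z \<in> unit_disk \<Longrightarrow> u z \<noteq> 0\<close> by (intro that[of s]) auto
qed

text \<open>The reciprocal of the odd root transform has the form \<open>1 / z + P z\<close> with
  \<open>deriv P 0 = - deriv s 0\<close>, and this is minus a quarter of the second derivative of
  \<open>\<phi>\<close> at 0. The bound 1 of the area theorem thus becomes 4.\<close>

theorem bieberbach_second_coefficient:
  assumes "\<phi> \<in> class_S"
  shows "cmod (deriv (deriv \<phi>) 0) \<le> 4"
proof -
  obtain s where s: "s holomorphic_on unit_disk" "\<And>z. z \<in> unit_disk \<Longrightarrow> s z \<noteq> 0" "s 0 = 1"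
    "\<And>z. z \<in> unit_disk \<Longrightarrow> \<phi> z = z * (s z)^2" "deriv (deriv \<phi>) 0 = 4 * deriv s 0"
    using class_S_has_root_transform[OF assms] by blast
  have inj: "inj_on \<phi> unit_disk" using assms by (simp add: class_S_def)
  have sq: "z^2 \<in> unit_disk" if "z \<in> unit_disk" for z :: complex
    using that by (simp add: norm_power power_less_one_iff)
  define Q where "Q = (\<lambda>z. 1 / s z - 1)"
  have Q: "Q holomorphic_on unit_disk" unfolding Q_def by (intro holomorphic_intros s) (use s in auto)
  have dQ: "deriv Q 0 = - deriv s 0"
  proof (rule DERIV_imp_deriv)
    have "(s has_field_derivative deriv s 0) (at 0)"
      by (rule holomorphic_derivI[OF s(1) open_ball]) simp
    then show "(Q has_field_derivative - deriv s 0) (at 0)"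
      unfolding Q_def using s(3) by (auto intro!: derivative_eq_intros)
  qed
  have "Q 0 = 0" using s by (simp add: Q_def)
  then obtain q where q: "q holomorphic_on unit_disk" "\<And>z. Q z = z * q z" "q 0 = - deriv s 0"
    using holomorphic_factor_at_0[OF Q open_ball] unfolding dQ by blast
  \<comment> \<open>Built from the factor \<open>q\<close> of \<open>1 / s - 1\<close> instead of as
    a difference of two poles, so that it is holomorphic at 0.\<close>
  define P where "P = (\<lambda>z. z * q (z^2))"
  have qq: "(\<lambda>z. q (z^2)) holomorphic_on unit_disk"
  proof -
    have "q \<circ> (\<lambda>z. z^2) holomorphic_on unit_disk"
      by (rule holomorphic_on_compose_gen[OF _ q(1)]) (use sq in \<open>auto intro!: holomorphic_intros\<close>)
    then show ?thesis by (simp add: o_def)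
  qed
  have P: "P holomorphic_on unit_disk"
    unfolding P_def by (intro holomorphic_intros qq)
  have dP: "deriv P 0 = - deriv s 0"
  proof (rule DERIV_imp_deriv)
    have "((\<lambda>z. q (z^2)) has_field_derivative deriv (\<lambda>z. q (z^2)) 0) (at 0)"
      by (rule holomorphic_derivI[OF qq open_ball]) simp
    then show "(P has_field_derivative - deriv s 0) (at 0)"
      unfolding P_def using q(3) by (auto intro!: derivative_eq_intros)
  qed
  have eq: "1 / z + P z = 1 / (z * s (z^2))" if "z \<in> unit_disk" "z \<noteq> 0" for z
  proof -
    have "P z = z * (Q (z^2) / z^2)" using that by (simp add: P_def q(2))
    also have "\<dots> = (1 / s (z^2) - 1) / z" using that by (simp add: Q_def power2_eq_square)
    finally show ?thesis using that by (simp add: diff_divide_distrib)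
  qed
  have "inj_on (\<lambda>z. 1 / z + P z) (unit_disk - {0})"
  proof (rule inj_onI)
    fix z w assume z: "z \<in> unit_disk - {0}" and w: "w \<in> unit_disk - {0}"
      and "1 / z + P z = 1 / w + P w"
    then have F: "z * s (z^2) = w * s (w^2)"
      using eq by (simp add: divide_inverse del: inverse_mult_distrib)
    have "\<phi> (z^2) = (z * s (z^2))^2" "\<phi> (w^2) = (w * s (w^2))^2"
      using z w sq s(4) by (auto simp: power_mult_distrib)
    then have "\<phi> (z^2) = \<phi> (w^2)" using F by simp
    \<comment> \<open>The remaining possibility \<open>z = - w\<close> is excluded by oddness: the
      factors \<open>s (z^2)\<close> and \<open>s (w^2)\<close> agree and cancel in
      \<open>F\<close>.\<close>
    then have zw: "z^2 = w^2" by (rule inj_onD[OF inj]) (use z w sq in blast)+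
    have "s (w^2) \<noteq> 0" using w by (intro s(2) sq) simp
    with F show "z = w" unfolding zw by simp
  qed
  from area_theorem[OF P this] show ?thesis using s(5) dP by (simp add: norm_mult)
qed

section \<open>Koebe transform and growth of the derivative along a radius\<close>

text \<open>Composition with the disk automorphism that takes 0 to \<open>a\<close>, followed by
  renormalisation, turns an estimate at the origin into one at \<open>a\<close>: the second
  derivative of the new function at 0 contains the quotient of the first two derivatives of
  \<open>\<phi>\<close> at \<open>a\<close>.\<close>

lemma koebe_transform_in_class_S:
  assumes "\<phi> \<in> class_S" and a: "cmod a < 1"
  defines "\<psi> \<equiv> \<lambda>z. (\<phi> ((z + a) / (1 + cnj a * z)) - \<phi> a) / (of_real (1 - (cmod a)^2) * deriv \<phi> a)"
  shows "deriv \<phi> a \<noteq> 0" "\<psi> \<in> class_S"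
    "deriv (deriv \<psi>) 0 = of_real (1 - (cmod a)^2) * deriv (deriv \<phi>) a / deriv \<phi> a - 2 * cnj a"
proof -
  have \<phi>: "\<phi> holomorphic_on unit_disk" "inj_on \<phi> unit_disk"
    using assms by (auto simp: class_S_def)
  have adisk: "a \<in> unit_disk" using a by simp
  show nz: "deriv \<phi> a \<noteq> 0"
    using holomorphic_injective_imp_regular[OF \<phi>(1) open_ball \<phi>(2) adisk] .
  define k where "k = of_real (1 - (cmod a)^2) * deriv \<phi> a"
  have "(cmod a)^2 < 1" using a by (simp add: power_less_one_iff)
  then have k: "k \<noteq> 0" using nz unfolding k_def by (simp only: mult_eq_0_iff of_real_eq_0_iff) simp
  define T where "T = (\<lambda>z. (z + a) / (1 + cnj a * z))"
  have aa: "of_real (1 - (cmod a)^2) = 1 - a * cnj a"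
    by (simp only: of_real_diff of_real_1 complex_norm_square)
  have den: "1 + cnj a * z \<noteq> 0" if "z \<in> unit_disk" for z
  proof
    assume "1 + cnj a * z = 0"
    then have "cmod (cnj a * z) = 1" by (metis add_eq_0_iff norm_minus_cancel norm_one)
    moreover have "cmod a * cmod z < 1 * 1" using a that by (intro mult_strict_mono') auto
    ultimately show False by (simp add: norm_mult)
  qed
  have Tdisk: "T z \<in> unit_disk" if z: "z \<in> unit_disk" for z
  proof -
    have "(cmod (1 + cnj a * z))^2 - (cmod (z + a))^2 = (1 - (cmod a)^2) * (1 - (cmod z)^2)"
      unfolding cmod_power2 by (simp add: power2_eq_square algebra_simps)
    also have "\<dots> > 0" using z a by (intro mult_pos_pos) (auto simp: power_less_one_iff)
    finally have "cmod (z + a) < cmod (1 + cnj a * z)"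
      by (simp add: power2_less_imp_less)
    then show ?thesis using den[OF z] by (simp add: T_def norm_divide)
  qed
  have T0: "T 0 = a" by (simp add: T_def)
  have dT: "(T has_field_derivative of_real (1 - (cmod a)^2) / (1 + cnj a * z)^2) (at z)"
    if "z \<in> unit_disk" for z
    unfolding T_def aa
  proof -
    have "((\<lambda>z. (z + a) / (1 + cnj a * z)) has_field_derivative
        (1 * (1 + cnj a * z) - (z + a) * cnj a) / ((1 + cnj a * z) * (1 + cnj a * z))) (at z)"
      using den[OF that] by (auto intro!: derivative_eq_intros)
    then show "((\<lambda>z. (z + a) / (1 + cnj a * z)) has_field_derivative
        (1 - a * cnj a) / (1 + cnj a * z)^2) (at z)"
      by (rule DERIV_cong) (simp add: power2_eq_square algebra_simps)
  qed
  have \<psi>: "\<psi> = (\<lambda>z. (\<phi> (T z) - \<phi> a) / k)" by (simp add: \<psi>_def T_def k_def)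
  have d\<psi>: "(\<psi> has_field_derivative deriv \<phi> (T z) * (of_real (1 - (cmod a)^2) / (1 + cnj a * z)^2) / k) (at z)"
    if z: "z \<in> unit_disk" for z
  proof -
    have "((\<lambda>z. \<phi> (T z)) has_field_derivative deriv \<phi> (T z) * (of_real (1 - (cmod a)^2) / (1 + cnj a * z)^2)) (at z)"
      by (rule DERIV_chain2[OF holomorphic_derivI[OF \<phi>(1) open_ball Tdisk[OF z]] dT[OF z]])
    then show ?thesis unfolding \<psi> by (intro DERIV_cdivide) (auto intro!: derivative_eq_intros)
  qed
  have hol: "\<psi> holomorphic_on unit_disk"
    unfolding holomorphic_on_open[OF open_ball] by (intro ballI exI) (rule d\<psi>)
  have inj: "inj_on \<psi> unit_disk"
  proof (rule inj_onI)
    fix z w assume z: "z \<in> unit_disk" and w: "w \<in> unit_disk" and "\<psi> z = \<psi> w"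
    then have "\<phi> (T z) = \<phi> (T w)" using k by (simp add: \<psi>)
    then have "T z = T w" by (rule inj_onD[OF \<phi>(2) _ Tdisk[OF z] Tdisk[OF w]])
    then have "(z + a) * (1 + cnj a * w) = (w + a) * (1 + cnj a * z)"
      using den[OF z] den[OF w] by (simp add: T_def frac_eq_eq)
    moreover have "(z + a) * (1 + cnj a * w) - (w + a) * (1 + cnj a * z) = (1 - a * cnj a) * (z - w)"
      by (simp add: algebra_simps)
    ultimately have "(1 - a * cnj a) * (z - w) = 0" by (metis right_minus_eq)
    moreover have "1 - a * cnj a \<noteq> 0"
      unfolding aa[symmetric] of_real_eq_0_iff using \<open>(cmod a)^2 < 1\<close> by linarith
    ultimately show "z = w" by (metis mult_eq_0_iff right_minus_eq)
  qed
  have "deriv \<psi> 0 = 1"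
    by (rule DERIV_imp_deriv, rule DERIV_cong, rule d\<psi>) (use k in \<open>auto simp: T0 k_def\<close>)
  then show "\<psi> \<in> class_S" using hol inj by (auto simp: class_S_def \<psi> T0)
  define c where "c = (of_real (1 - (cmod a)^2) :: complex)"
  have c: "c \<noteq> 0" using \<open>(cmod a)^2 < 1\<close> unfolding c_def by (simp only: of_real_eq_0_iff)
  have "deriv \<phi> holomorphic_on unit_disk" using \<phi> by (intro holomorphic_deriv) auto
  then have "(deriv \<phi> has_field_derivative deriv (deriv \<phi>) (T 0)) (at (T 0))"
    by (rule holomorphic_derivI[OF _ open_ball]) (simp add: T0 a)
  from DERIV_chain2[OF this dT[of 0]]
  have 1: "((\<lambda>z. deriv \<phi> (T z)) has_field_derivative deriv (deriv \<phi>) a * c) (at 0)"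
    by (simp add: T0 c_def)
  have "((\<lambda>z. deriv \<phi> (T z) * (c / (1 + cnj a * z)^2) / k) has_field_derivative
      (deriv (deriv \<phi>) a * c * c - deriv \<phi> a * c * 2 * cnj a) / k) (at 0)"
  proof -
    have "((\<lambda>z. 1 + cnj a * z) has_field_derivative cnj a) (at 0)"
      by (auto intro!: derivative_eq_intros)
    from DERIV_divide[OF DERIV_const DERIV_power[OF this, of 2], of c]
    have 2: "((\<lambda>z. c / (1 + cnj a * z)^2) has_field_derivative - (c * (2 * cnj a))) (at 0)"
      by simp
    show ?thesis
      by (rule DERIV_cong[OF DERIV_cdivide[OF DERIV_mult[OF 1 2]]]) (simp add: T0 algebra_simps)
  qed
  then have "(deriv \<psi> has_field_derivative
      (deriv (deriv \<phi>) a * c * c - deriv \<phi> a * c * 2 * cnj a) / k) (at 0)"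
    by (rule has_field_derivative_transform_within_open[OF _ open_ball[of 0 1]])
       (auto simp: c_def DERIV_imp_deriv[OF d\<psi>])
  then have "deriv (deriv \<psi>) 0 = (deriv (deriv \<phi>) a * c * c - deriv \<phi> a * c * 2 * cnj a) / k"
    by (rule DERIV_imp_deriv)
  also have "\<dots> = c * deriv (deriv \<phi>) a / deriv \<phi> a - 2 * cnj a"
    using nz c unfolding k_def c_def[symmetric] by (simp add: field_simps)
  finally show "deriv (deriv \<psi>) 0 = of_real (1 - (cmod a)^2) * deriv (deriv \<phi>) a / deriv \<phi> a - 2 * cnj a"
    by (simp add: c_def)
qed

text \<open>Multiplying by \<open>a\<close> makes the quotient the radial logarithmic derivative of
  the derivative of \<open>\<phi>\<close>, and makes the correction term the real number
  \<open>2 |a|^2\<close>.\<close>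

lemma pre_schwarzian_bound:
  assumes "\<phi> \<in> class_S" and a: "cmod a < 1"
  shows "(1 - (cmod a)^2) * Re (a * deriv (deriv \<phi>) a / deriv \<phi> a) \<le> 2 * (cmod a)^2 + 4 * cmod a"
proof -
  define X where "X = of_real (1 - (cmod a)^2) * deriv (deriv \<phi>) a / deriv \<phi> a"
  have "cmod (X - 2 * cnj a) \<le> 4"
    using bieberbach_second_coefficient[OF koebe_transform_in_class_S(2)[OF assms]]
    unfolding koebe_transform_in_class_S(3)[OF assms] X_def .
  then have "cmod (a * (X - 2 * cnj a)) \<le> cmod a * 4"
    unfolding norm_mult by (intro mult_left_mono) auto
  then have "Re (a * (X - 2 * cnj a)) \<le> 4 * cmod a"
    using complex_Re_le_cmod[of "a * (X - 2 * cnj a)"] by linarith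
  moreover have "a * (X - 2 * cnj a) = of_real (1 - (cmod a)^2) * (a * deriv (deriv \<phi>) a / deriv \<phi> a) - of_real (2 * (cmod a)^2)"
    unfolding X_def of_real_mult[of 2] complex_norm_square by (simp add: algebra_simps)
  then have "Re (a * (X - 2 * cnj a)) = (1 - (cmod a)^2) * Re (a * deriv (deriv \<phi>) a / deriv \<phi> a) - 2 * (cmod a)^2"
    by (simp only: minus_complex.sel Re_complex_of_real times_complex.sel Im_complex_of_real mult_zero_left diff_zero)
  ultimately show ?thesis by linarith
qed

text \<open>The bound \<open>(1 + t) / (1 - t)^3\<close> has logarithmic derivative
  \<open>(4 + 2 t) / (1 - t^2)\<close>, exactly what \<open>pre_schwarzian_bound\<close> allows for
  \<open>|deriv \<phi>|\<close> along a radius. Squared moduli avoid logarithms.\<close>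

theorem koebe_distortion_upper:
  assumes "\<phi> \<in> class_S" and z: "cmod z < 1"
  shows "cmod (deriv \<phi> z) \<le> (1 + cmod z) / (1 - cmod z)^3"
proof (cases "z = 0")
  case True
  then show ?thesis using assms by (simp add: class_S_def)
next
  case False
  define r where "r = cmod z"
  have r: "0 < r" "r < 1" using False z by (auto simp: r_def)
  define u where "u = z / of_real r"
  have u: "cmod u = 1" "z = of_real r * u" using r by (auto simp: u_def r_def norm_divide)
  have \<phi>: "\<phi> holomorphic_on unit_disk" using assms by (auto simp: class_S_def)
  then have \<phi>': "deriv \<phi> holomorphic_on unit_disk" by (intro holomorphic_deriv) auto
  define w where "w = (\<lambda>t. deriv \<phi> (of_real t * u))"
  define w' where "w' = (\<lambda>t. deriv (deriv \<phi>) (of_real t * u) * u)"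
  \<comment> \<open>The quotient of \<open>|\<phi>'|\<^sup>2\<close> and its upper bound decreases along the radius.\<close>
  define m where "m = (\<lambda>t. (cmod (w t))^2 * ((1 - t)^6 / (1 + t)^2))"
  have "m r \<le> m 0"
  proof (rule DERIV_nonpos_imp_nonincreasing[of 0 r])
    show "0 \<le> r" using r by simp
    fix t assume t: "0 \<le> t" "t \<le> r"
    then have t1: "t < 1" using r by simp
    have td: "of_real t * u \<in> unit_disk" using t t1 u by (simp add: norm_mult)
    have "((\<lambda>t. of_real t * u) has_vector_derivative u) (at t)"
      by (auto intro!: derivative_eq_intros)
    from field_vector_diff_chain_at[OF this holomorphic_derivI[OF \<phi>' open_ball td]]
    have dw: "(w has_vector_derivative w' t) (at t)"
      by (simp add: o_def w_def w'_def mult.commute)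
    have dRe: "((\<lambda>t. Re (w t)) has_real_derivative Re (w' t)) (at t)"
      and dIm: "((\<lambda>t. Im (w t)) has_real_derivative Im (w' t)) (at t)"
      using dw unfolding has_real_derivative_iff_has_vector_derivative
      by (auto intro: bounded_linear.has_vector_derivative[OF bounded_linear_Re] bounded_linear.has_vector_derivative[OF bounded_linear_Im])
    have dn: "((\<lambda>t. (cmod (w t))^2) has_real_derivative 2 * Re (cnj (w t) * w' t)) (at t)"
      unfolding cmod_power2
      by (rule DERIV_cong[OF DERIV_add[OF DERIV_power[OF dRe] DERIV_power[OF dIm]]]) (simp add: algebra_simps)
    have dm: "(m has_real_derivative
        2 * Re (cnj (w t) * w' t) * ((1 - t)^6 / (1 + t)^2)
          + (cmod (w t))^2 * (- (8 + 4 * t) * (1 - t)^5 / (1 + t)^3)) (at t)"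
    proof -
      have "((\<lambda>t. (1 - t)^6 / (1 + t)^2) has_real_derivative
          ((6 * (1 - t)^5 * (-1)) * (1 + t)^2 - (1 - t)^6 * (2 * (1 + t))) / ((1 + t)^2 * (1 + t)^2)) (at t)"
        using t by (auto intro!: derivative_eq_intros)
      \<comment> \<open>With \<open>a = 1 - t\<close> and \<open>b = 1 + t\<close> the coefficient
        \<open>6 b + 2 a\<close> is the \<open>8 + 4 t\<close> below.\<close>
      moreover have "((6 * a^5 * (-1)) * b^2 - a^6 * (2 * b)) / (b^2 * b^2) = - (6 * b + 2 * a) * a^5 / b^3"
        if "b \<noteq> 0" for a b :: real
        using that by (simp add: field_simps eval_nat_numeral)
      from this[of "1 + t" "1 - t"] have "((6 * (1 - t)^5 * (-1)) * (1 + t)^2 - (1 - t)^6 * (2 * (1 + t))) / ((1 + t)^2 * (1 + t)^2)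
          = - (8 + 4 * t) * (1 - t)^5 / (1 + t)^3" using t by simp
      ultimately have "((\<lambda>t. (1 - t)^6 / (1 + t)^2) has_real_derivative - (8 + 4 * t) * (1 - t)^5 / (1 + t)^3) (at t)"
        by (rule DERIV_cong)
      from DERIV_mult[OF dn this] show ?thesis unfolding m_def by (simp add: algebra_simps)
    qed
    have "2 * Re (cnj (w t) * w' t) * (1 - t^2) \<le> (cmod (w t))^2 * (8 + 4 * t)"
    \<comment> \<open>The bound from the Koebe transform carries a factor \<open>t\<close> and says
      nothing at the origin; there the second coefficient bound is used directly.\<close>
    proof (cases "t = 0")
      case True
      have "deriv \<phi> 0 = 1" using assms by (simp add: class_S_def)
      moreover have "cmod (deriv (deriv \<phi>) 0 * u) \<le> 4"
        using bieberbach_second_coefficient[OF assms(1)] u by (simp add: norm_mult)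
      ultimately show ?thesis
        using complex_Re_le_cmod[of "deriv (deriv \<phi>) 0 * u"] True by (simp add: w_def w'_def)
    next
      case False
      have nz: "w t \<noteq> 0"
        unfolding w_def using koebe_transform_in_class_S(1)[OF assms(1)] td by simp
      have nt: "cmod (of_real t * u) = t" using t u by (simp add: norm_mult)
      define X where "X = Re (w' t / w t)"
      have "of_real t * u * deriv (deriv \<phi>) (of_real t * u) / deriv \<phi> (of_real t * u) = of_real t * (w' t / w t)"
        by (simp add: w_def w'_def mult_ac)
      then have "Re (of_real t * u * deriv (deriv \<phi>) (of_real t * u) / deriv \<phi> (of_real t * u)) = t * X"
        unfolding X_def by (simp only: times_complex.sel(1) Re_complex_of_real Im_complex_of_real mult_zero_left diff_zero)
      then have "(1 - t^2) * (t * X) \<le> 2 * t^2 + 4 * t"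
        using pre_schwarzian_bound[OF assms(1), of "of_real t * u"] t1 unfolding nt by metis
      then have "t * ((1 - t^2) * X) \<le> t * (2 * t + 4)"
        by (simp add: algebra_simps power2_eq_square)
      then have "(1 - t^2) * X \<le> 2 * t + 4"
        using t False by simp
      then have "(cmod (w t))^2 * ((1 - t^2) * X) \<le> (cmod (w t))^2 * (2 * t + 4)"
        by (rule mult_left_mono) simp
      moreover have "cnj (w t) * w' t = of_real ((cmod (w t))^2) * (w' t / w t)"
        unfolding complex_norm_square using nz by simp
      then have "Re (cnj (w t) * w' t) = (cmod (w t))^2 * X"
        unfolding X_def by (simp only: times_complex.sel(1) Re_complex_of_real Im_complex_of_real mult_zero_left diff_zero)
      then have "2 * Re (cnj (w t) * w' t) * (1 - t^2) = 2 * ((cmod (w t))^2 * ((1 - t^2) * X))"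
        by (simp only: mult_ac)
      ultimately show ?thesis by (simp add: algebra_simps)
    qed
    then have "(2 * Re (cnj (w t) * w' t) * (1 - t^2)) * ((1 - t)^5 / (1 + t)^3) \<le> ((cmod (w t))^2 * (8 + 4 * t)) * ((1 - t)^5 / (1 + t)^3)"
      using t t1 by (intro mult_right_mono) auto
    also have "(2 * Re (cnj (w t) * w' t) * (1 - t^2)) * ((1 - t)^5 / (1 + t)^3) = 2 * Re (cnj (w t) * w' t) * ((1 - t)^6 / (1 + t)^2)"
    proof -
      have "(a * b) * (a^5 / b^3) = a^6 / b^2" if "b \<noteq> 0" for a b :: real
        using that by (simp add: field_simps eval_nat_numeral)
      moreover have "1 - t^2 = (1 - t) * (1 + t)" by (simp add: algebra_simps power2_eq_square)
      ultimately have "(1 - t^2) * ((1 - t)^5 / (1 + t)^3) = (1 - t)^6 / (1 + t)^2" using t by simp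
      then show ?thesis by (simp only: mult.assoc)
    qed
    finally have "2 * Re (cnj (w t) * w' t) * ((1 - t)^6 / (1 + t)^2)
          + (cmod (w t))^2 * (- (8 + 4 * t) * (1 - t)^5 / (1 + t)^3) \<le> 0"
    proof -
      have "y + W * (- k * c / d) \<le> 0" if "y \<le> (W * k) * (c / d)" for y W k c d :: real
        using that by simp
      then show "y \<le> ((cmod (w t))^2 * (8 + 4 * t)) * ((1 - t)^5 / (1 + t)^3) \<Longrightarrow>
          y + (cmod (w t))^2 * (- (8 + 4 * t) * (1 - t)^5 / (1 + t)^3) \<le> 0" for y .
    qed
    with dm show "\<exists>y. (m has_real_derivative y) (at t) \<and> y \<le> 0" by blast
  qed
  moreover have "m 0 = 1" using assms by (simp add: m_def w_def class_S_def)
  moreover have "m r = (cmod (deriv \<phi> z) * ((1 - r)^3 / (1 + r)))^2"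
  proof -
    have "(1 - r)^6 = ((1 - r)^3)^2" unfolding power_mult[symmetric] by simp
    then show ?thesis
      unfolding m_def w_def u(2)[symmetric] by (simp only: power_mult_distrib power_divide)
  qed
  ultimately have "(cmod (deriv \<phi> z) * ((1 - r)^3 / (1 + r)))^2 \<le> 1^2" by simp
  then have "cmod (deriv \<phi> z) * ((1 - r)^3 / (1 + r)) \<le> 1"
    by (rule power2_le_imp_le) simp
  then show ?thesis unfolding r_def[symmetric] using r by (simp add: field_simps)
qed

section \<open>Harmonic mappings\<close>

lemma harmonic_parts_has_derivative:
  assumes "harmonic_parts f h g" and z: "z \<in> unit_disk"
  shows "(f has_derivative (\<lambda>d. deriv h z * d + cnj (deriv g z * d))) (at z)"
proof -
  have h: "h holomorphic_on unit_disk" and g: "g holomorphic_on unit_disk"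
    and f: "\<And>z. z \<in> unit_disk \<Longrightarrow> f z = h z + cnj (g z)"
    using assms by (auto simp: harmonic_parts_def)
  have "(h has_derivative (\<lambda>d. deriv h z * d)) (at z)" "(g has_derivative (\<lambda>d. deriv g z * d)) (at z)"
    using holomorphic_derivI[OF h open_ball z] holomorphic_derivI[OF g open_ball z]
    by (simp_all add: has_field_derivative_def)
  then have "((\<lambda>z. h z + cnj (g z)) has_derivative (\<lambda>d. deriv h z * d + cnj (deriv g z * d))) (at z)"
    by (intro has_derivative_add has_derivative_cnj)
  then show ?thesis
    by (rule has_derivative_transform_within_open[OF _ open_ball z]) (simp add: f)
qed

lemma dzbar_harmonic_parts:
  assumes "harmonic_parts f h g" "z \<in> unit_disk"
  shows "dzbar f z = cnj (deriv g z)"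
  using frechet_derivative_at[OF harmonic_parts_has_derivative[OF assms], symmetric]
  by (simp add: dzbar_def algebra_simps)

text \<open>The real derivative of \<open>f\<close> in the directions 1 and \<open>\<i>\<close>
  determines both coefficients. This reconciles the witnesses \<open>h\<close>, \<open>g\<close>,
  which the class definitions quantify independently of each other.\<close>

lemma harmonic_parts_unique:
  assumes P: "harmonic_parts f h g" and P': "harmonic_parts f h' g'" and z: "z \<in> unit_disk"
  shows "deriv h z = deriv h' z" "deriv g z = deriv g' z"
proof -
  have eq: "(\<lambda>d. deriv h z * d + cnj (deriv g z * d)) = (\<lambda>d. deriv h' z * d + cnj (deriv g' z * d))"
    using harmonic_parts_has_derivative[OF P z] harmonic_parts_has_derivative[OF P' z]
    by (rule has_derivative_unique)
  have 1: "deriv h z + cnj (deriv g z) = deriv h' z + cnj (deriv g' z)"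
    using fun_cong[OF eq, of 1] by simp
  have "\<i> * (deriv h z - cnj (deriv g z)) = \<i> * (deriv h' z - cnj (deriv g' z))"
    using fun_cong[OF eq, of \<i>] by (simp add: algebra_simps)
  then have 2: "deriv h z - cnj (deriv g z) = deriv h' z - cnj (deriv g' z)"
    by (simp only: mult_cancel_left complex_i_not_zero simp_thms)
  have "2 * deriv h z = 2 * deriv h' z" using arg_cong2[OF 1 2, of "(+)"] by (simp add: algebra_simps)
  then show "deriv h z = deriv h' z" by simp
  with 1 show "deriv g z = deriv g' z" by simp
qed

lemma harmonic_parts_sense_preserving:
  assumes "harmonic_parts f h g" "sense_preserving f" "z \<in> unit_disk"
  shows "cmod (deriv g z) < cmod (deriv h z)"
proof -
  obtain h' g' where *: "harmonic_parts f h' g'" "(cmod (deriv h' z))\<^sup>2 - (cmod (deriv g' z))\<^sup>2 > 0"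
    using assms by (auto simp: sense_preserving_def)
  then have "(cmod (deriv g z))\<^sup>2 < (cmod (deriv h z))\<^sup>2"
    using harmonic_parts_unique[OF assms(1) *(1) assms(3)] by simp
  then show ?thesis by (rule power2_less_imp_less) simp
qed

section \<open>Affine changes and the derivative bounds\<close>

text \<open>Conjugation exchanges the roles of the parts, since
  \<open>c * cnj (h0 + cnj g0) = c * g0 + cnj (cnj c * h0)\<close>. The condition
  \<open>deriv g0 0 = 0\<close> preserves the normalisation of the analytic part.\<close>

lemma harmonic_parts_affine:
  assumes P: "harmonic_parts f0 h0 g0" and g0: "deriv g0 0 = 0"
    and f: "\<forall>z\<in>unit_disk. f z = f0 z + c * cnj (f0 z)"
  shows "harmonic_parts f (\<lambda>z. h0 z + c * g0 z) (\<lambda>z. g0 z + cnj c * h0 z)"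
    and "\<And>z. z \<in> unit_disk \<Longrightarrow> deriv (\<lambda>z. h0 z + c * g0 z) z = deriv h0 z + c * deriv g0 z"
    and "\<And>z. z \<in> unit_disk \<Longrightarrow> deriv (\<lambda>z. g0 z + cnj c * h0 z) z = deriv g0 z + cnj c * deriv h0 z"
proof -
  have h: "h0 holomorphic_on unit_disk" and g: "g0 holomorphic_on unit_disk"
    using P by (auto simp: harmonic_parts_def)
  show 1: "deriv (\<lambda>z. h0 z + c * g0 z) z = deriv h0 z + c * deriv g0 z" if "z \<in> unit_disk" for z
    using holomorphic_derivI[OF h open_ball that] holomorphic_derivI[OF g open_ball that]
    by (intro DERIV_imp_deriv DERIV_add DERIV_cmult)
  show "deriv (\<lambda>z. g0 z + cnj c * h0 z) z = deriv g0 z + cnj c * deriv h0 z" if "z \<in> unit_disk" for z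
    using holomorphic_derivI[OF h open_ball that] holomorphic_derivI[OF g open_ball that]
    by (intro DERIV_imp_deriv DERIV_add DERIV_cmult)
  show "harmonic_parts f (\<lambda>z. h0 z + c * g0 z) (\<lambda>z. g0 z + cnj c * h0 z)"
    using P f 1[of 0] g0 unfolding harmonic_parts_def
    by (auto intro!: holomorphic_intros simp: algebra_simps)
qed

lemma class_SH0_S_deriv_bounds:
  assumes f0: "f0 \<in> class_SH0_S" and P: "harmonic_parts f0 h0 g0" and z: "cmod z < 1"
  shows "cmod (deriv h0 z) \<le> (1 + cmod z) / (1 - cmod z)^4"
    and "cmod (deriv g0 z) \<le> cmod z * cmod (deriv h0 z)"
proof -
  obtain h g \<theta> where hg: "harmonic_parts f0 h g"
    "(\<lambda>z. h z + exp (\<i> * of_real \<theta>) * g z) \<in> class_S"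
    using f0 by (auto simp: class_SH0_S_def)
  have sp: "sense_preserving f0" and "dzbar f0 0 = 0"
    using f0 by (auto simp: class_SH0_S_def class_SH0_def class_SH_def)
  have zD: "z \<in> unit_disk" using z by simp
  have hol: "h holomorphic_on unit_disk" "g holomorphic_on unit_disk"
    using hg(1) by (auto simp: harmonic_parts_def)
  have g0: "deriv g 0 = 0"
    using \<open>dzbar f0 0 = 0\<close> dzbar_harmonic_parts[OF hg(1), of 0] by simp
  have lt: "cmod (deriv g w) < cmod (deriv h w)" if "w \<in> unit_disk" for w
    using harmonic_parts_sense_preserving[OF hg(1) sp that] .
  then have nz: "deriv h w \<noteq> 0" if "w \<in> unit_disk" for w using that by fastforce
  define \<omega> where "\<omega> = (\<lambda>w. deriv g w / deriv h w)"
  have "\<omega> holomorphic_on unit_disk" unfolding \<omega>_def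
    using nz by (intro holomorphic_intros holomorphic_deriv hol) auto
  moreover have "\<omega> 0 = 0" by (simp add: \<omega>_def g0)
  moreover have "cmod (\<omega> w) < 1" if "cmod w < 1" for w
    using lt[of w] that nz[of w] by (simp add: \<omega>_def norm_divide)
  ultimately have \<omega>: "cmod (\<omega> z) \<le> cmod z"
    by (rule Schwarz_Lemma(1)) (use z in auto)
  then have g: "cmod (deriv g z) \<le> cmod z * cmod (deriv h z)"
    using nz[OF zD] by (simp add: \<omega>_def norm_divide divide_simps)
  then show "cmod (deriv g0 z) \<le> cmod z * cmod (deriv h0 z)"
    using harmonic_parts_unique[OF P hg(1) zD] by simp
  define e where "e = exp (\<i> * of_real \<theta>)"
  have e: "cmod e = 1" by (simp add: e_def)
  have "deriv (\<lambda>z. h z + e * g z) z = deriv h z + e * deriv g z"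
    using holomorphic_derivI[OF hol(1) open_ball zD] holomorphic_derivI[OF hol(2) open_ball zD]
    by (intro DERIV_imp_deriv DERIV_add DERIV_cmult)
  then have "cmod (deriv h z + e * deriv g z) \<le> (1 + cmod z) / (1 - cmod z)^3"
    using koebe_distortion_upper[OF hg(2) z] by (simp add: e_def)
  moreover have "cmod (deriv h z) - cmod (e * deriv g z) \<le> cmod (deriv h z + e * deriv g z)"
    by (rule norm_diff_ineq)
  \<comment> \<open>Since \<open>|g'| \<le> |z| |h'|\<close>, at least \<open>(1 - |z|) |h'|\<close>
    survives in the combination; dividing by \<open>1 - |z|\<close> raises the exponent from 3 to
    4.\<close>
  ultimately have "(1 - cmod z) * cmod (deriv h z) \<le> (1 + cmod z) / (1 - cmod z)^3"
    using g e by (simp add: norm_mult algebra_simps)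
  then have "cmod (deriv h z) \<le> (1 + cmod z) / (1 - cmod z)^3 / (1 - cmod z)"
    using z by (simp add: pos_le_divide_eq mult_ac)
  also have "\<dots> = (1 + cmod z) / (1 - cmod z)^4"
    by (simp add: power_eq_if[of _ 4])
  finally show "cmod (deriv h0 z) \<le> (1 + cmod z) / (1 - cmod z)^4"
    using harmonic_parts_unique[OF P hg(1) zD] by simp
qed

lemma class_SH_S_deriv_bounds:
  assumes f: "f \<in> class_SH_S" and P: "harmonic_parts f h g" and z: "cmod z < 1"
  shows "cmod (deriv h z) \<le> (1 + cmod z * cmod (dzbar f 0)) * ((1 + cmod z) / (1 - cmod z)^4)"
    and "cmod (deriv g z) \<le> (cmod z + cmod (dzbar f 0)) * ((1 + cmod z) / (1 - cmod z)^4)"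
proof -
  obtain f0 c where f0: "f0 \<in> class_SH0_S" and fc: "\<forall>z\<in>unit_disk. f z = f0 z + c * cnj (f0 z)"
    using f unfolding class_SH_S_def by blast
  obtain h0 g0 where P0: "harmonic_parts f0 h0 g0" using f0 by (auto simp: class_SH0_S_def)
  have "dzbar f0 0 = 0" using f0 by (auto simp: class_SH0_S_def class_SH0_def)
  then have g00: "deriv g0 0 = 0" using dzbar_harmonic_parts[OF P0, of 0] by simp
  note aff = harmonic_parts_affine[OF P0 g00 fc]
  have "deriv h0 0 = 1" using P0 by (simp add: harmonic_parts_def)
  then have c: "dzbar f 0 = c"
    using dzbar_harmonic_parts[OF aff(1), of 0] aff(3)[of 0] g00 by simp
  have zD: "z \<in> unit_disk" using z by simp
  have dh: "deriv h z = deriv h0 z + c * deriv g0 z" and dg: "deriv g z = deriv g0 z + cnj c * deriv h0 z"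
    using harmonic_parts_unique[OF P aff(1) zD] aff(2,3)[OF zD] by auto
  note b = class_SH0_S_deriv_bounds[OF f0 P0 z]
  have "cmod (deriv h z) \<le> cmod (deriv h0 z) + cmod c * cmod (deriv g0 z)"
    unfolding dh using norm_triangle_ineq[of "deriv h0 z" "c * deriv g0 z"] by (simp add: norm_mult)
  also have "\<dots> \<le> cmod (deriv h0 z) + cmod c * (cmod z * cmod (deriv h0 z))"
    by (intro add_left_mono mult_left_mono b(2)) auto
  also have "\<dots> = (1 + cmod z * cmod c) * cmod (deriv h0 z)" by (simp add: algebra_simps)
  also have "\<dots> \<le> (1 + cmod z * cmod c) * ((1 + cmod z) / (1 - cmod z)^4)"
    by (intro mult_left_mono b(1)) auto
  finally show "cmod (deriv h z) \<le> (1 + cmod z * cmod (dzbar f 0)) * ((1 + cmod z) / (1 - cmod z)^4)"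
    unfolding c .
  have "cmod (deriv g z) \<le> cmod (deriv g0 z) + cmod c * cmod (deriv h0 z)"
    unfolding dg using norm_triangle_ineq[of "deriv g0 z" "cnj c * deriv h0 z"] by (simp add: norm_mult)
  also have "\<dots> \<le> cmod z * cmod (deriv h0 z) + cmod c * cmod (deriv h0 z)"
    by (intro add_right_mono b(2))
  also have "\<dots> = (cmod z + cmod c) * cmod (deriv h0 z)" by (simp add: algebra_simps)
  also have "\<dots> \<le> (cmod z + cmod c) * ((1 + cmod z) / (1 - cmod z)^4)"
    by (intro mult_left_mono b(1)) auto
  finally show "cmod (deriv g z) \<le> (cmod z + cmod (dzbar f 0)) * ((1 + cmod z) / (1 - cmod z)^4)"
    unfolding c .
qed

text \<open>\<open>f\<close> is \<open>f0\<close> followed by \<open>ellipse_map (- c)\<close>, a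
  bijection of the plane whose determinant \<open>1 - |c|^2\<close> multiplies the Jacobian of
  \<open>f0\<close>.\<close>

lemma affine_class_SH:
  assumes f0: "f0 \<in> class_SH0" and c: "cmod c < 1"
    and fc: "\<forall>z\<in>unit_disk. f z = f0 z + c * cnj (f0 z)"
  shows "f \<in> class_SH"
proof -
  have sp: "sense_preserving f0" and inj: "inj_on f0 unit_disk" and "dzbar f0 0 = 0"
    using f0 by (auto simp: class_SH0_def class_SH_def)
  obtain h0 g0 where P0: "harmonic_parts f0 h0 g0"
    using f0 by (auto simp: class_SH0_def class_SH_def class_H_def)
  have g00: "deriv g0 0 = 0" using \<open>dzbar f0 0 = 0\<close> dzbar_harmonic_parts[OF P0, of 0] by simp
  note aff = harmonic_parts_affine[OF P0 g00 fc]
  have "(cmod (deriv h0 z + c * deriv g0 z))\<^sup>2 - (cmod (deriv g0 z + cnj c * deriv h0 z))\<^sup>2 > 0"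
    if z: "z \<in> unit_disk" for z
  proof -
    have "(cmod (deriv h0 z + c * deriv g0 z))\<^sup>2 - (cmod (deriv g0 z + cnj c * deriv h0 z))\<^sup>2
        = (1 - (cmod c)\<^sup>2) * ((cmod (deriv h0 z))\<^sup>2 - (cmod (deriv g0 z))\<^sup>2)"
      unfolding cmod_power2 by (simp add: power2_eq_square algebra_simps)
    moreover have "(cmod c)\<^sup>2 < 1" using c by (simp add: power_less_one_iff)
    moreover have "(cmod (deriv g0 z))\<^sup>2 < (cmod (deriv h0 z))\<^sup>2"
      using harmonic_parts_sense_preserving[OF P0 sp z] by (intro power_strict_mono) auto
    ultimately show ?thesis by simp
  qed
  then have "sense_preserving f"
    unfolding sense_preserving_def using aff by (intro exI conjI[OF aff(1)]) auto
  moreover have "inj_on f unit_disk"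
  proof (rule inj_onI)
    fix z w assume z: "z \<in> unit_disk" and w: "w \<in> unit_disk" and "f z = f w"
    then have "ellipse_map (- c) (f0 z) = ellipse_map (- c) (f0 w)"
      by (simp add: fc ellipse_map_def)
    then have "f0 z = f0 w" using bij_ellipse_map[of "- c"] c by (simp add: bij_def inj_eq)
    then show "z = w" using z w by (rule inj_onD[OF inj])
  qed
  ultimately show ?thesis using aff(1) by (auto simp: class_SH_def class_H_def)
qed

section \<open>The harmonic Koebe function\<close>

definition koebe_h :: "complex \<Rightarrow> complex" where
  "koebe_h z = (z - 1/2 * z^2 + 1/6 * z^3) / (1 - z)^3"

definition koebe_g :: "complex \<Rightarrow> complex" where
  "koebe_g z = (1/2 * z^2 + 1/6 * z^3) / (1 - z)^3"

lemma harmonic_koebe_eq: "harmonic_koebe z = koebe_h z + cnj (koebe_g z)"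
  by (simp add: harmonic_koebe_def koebe_h_def koebe_g_def)

lemma koebe_h_deriv:
  assumes "z \<noteq> 1"
  shows "(koebe_h has_field_derivative (1 + z) / (1 - z)^4) (at z)"
proof -
  have nz: "1 - z \<noteq> 0" using assms by simp
  have "((\<lambda>z. (z - 1/2 * z^2 + 1/6 * z^3) / (1 - z)^3) has_field_derivative
      ((1 - z + 1/2 * z^2) * (1 - z)^3 - (z - 1/2 * z^2 + 1/6 * z^3) * (- 3 * (1 - z)^2)) / ((1 - z)^3 * (1 - z)^3)) (at z)"
    using nz by (auto intro!: derivative_eq_intros simp: power2_eq_square)
  also have "((1 - z + 1/2 * z^2) * (1 - z)^3 - (z - 1/2 * z^2 + 1/6 * z^3) * (- 3 * (1 - z)^2)) / ((1 - z)^3 * (1 - z)^3)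
      = ((1 - z + 1/2 * z^2) * (1 - z) + 3 * (z - 1/2 * z^2 + 1/6 * z^3)) / (1 - z)^4"
  proof -
    have "(A * v^3 - B * (- 3 * v^2)) / (v^3 * v^3) = (A * v + 3 * B) / v^4" if "v \<noteq> 0" for A B v :: complex
      using that by (simp add: field_simps eval_nat_numeral)
    then show ?thesis using nz by blast
  qed
  also have "(1 - z + 1/2 * z^2) * (1 - z) + 3 * (z - 1/2 * z^2 + 1/6 * z^3) = 1 + z"
    by (simp add: field_simps eval_nat_numeral)
  finally show ?thesis unfolding koebe_h_def[abs_def] .
qed

text \<open>Compared with \<open>koebe_h_deriv\<close>, this shows that the dilatation is
  \<open>z\<close>, an equality case of the Schwarz lemma.\<close>

lemma koebe_g_deriv:
  assumes "z \<noteq> 1"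
  shows "(koebe_g has_field_derivative z * (1 + z) / (1 - z)^4) (at z)"
proof -
  have nz: "1 - z \<noteq> 0" using assms by simp
  have "((\<lambda>z. (1/2 * z^2 + 1/6 * z^3) / (1 - z)^3) has_field_derivative
      ((z + 1/2 * z^2) * (1 - z)^3 - (1/2 * z^2 + 1/6 * z^3) * (- 3 * (1 - z)^2)) / ((1 - z)^3 * (1 - z)^3)) (at z)"
    using nz by (auto intro!: derivative_eq_intros simp: power2_eq_square)
  also have "((z + 1/2 * z^2) * (1 - z)^3 - (1/2 * z^2 + 1/6 * z^3) * (- 3 * (1 - z)^2)) / ((1 - z)^3 * (1 - z)^3)
      = ((z + 1/2 * z^2) * (1 - z) + 3 * (1/2 * z^2 + 1/6 * z^3)) / (1 - z)^4"
  proof -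
    have "(A * v^3 - B * (- 3 * v^2)) / (v^3 * v^3) = (A * v + 3 * B) / v^4" if "v \<noteq> 0" for A B v :: complex
      using that by (simp add: field_simps eval_nat_numeral)
    then show ?thesis using nz by blast
  qed
  also have "(z + 1/2 * z^2) * (1 - z) + 3 * (1/2 * z^2 + 1/6 * z^3) = z * (1 + z)"
    by (simp add: field_simps eval_nat_numeral)
  finally show ?thesis unfolding koebe_g_def[abs_def] .
qed

text \<open>The classical Koebe function, extremal in the distortion theorem. It supplies the
  univalent combination required by \<open>class_SH0_S\<close>.\<close>

lemma koebe_h_minus_koebe_g:
  assumes "z \<noteq> 1"
  shows "koebe_h z - koebe_g z = z / (1 - z)^2"
proof -
  have "koebe_h z - koebe_g z = (z * (1 - z)) / (1 - z)^3"
    by (simp add: koebe_h_def koebe_g_def diff_divide_distrib[symmetric] algebra_simps power2_eq_square)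
  then show ?thesis using assms by (simp add: power3_eq_cube power2_eq_square)
qed

section \<open>The half-plane model: injectivity and range\<close>

definition koebe_half_plane :: "real \<Rightarrow> real \<Rightarrow> complex" where
  "koebe_half_plane x y = Complex ((x^3 - 3 * x * y^2 - 1) / 6) (x * y / 2)"

text \<open>In the half-plane variable \<open>u = (1 + z) / (1 - z)\<close> the analytic and co-analytic parts have sum
  \<open>(u\<^sup>3 - 1) / 6\<close> and difference \<open>(u\<^sup>2 - 1) / 4\<close>.\<close>

lemma harmonic_koebe_cayley:
  assumes "z \<noteq> 1"
  defines "u \<equiv> (1 + z) / (1 - z)"
  shows "harmonic_koebe z = koebe_half_plane (Re u) (Im u)"
proof -
  define v where "v = 1 - z"
  have v: "v \<noteq> 0" "z = 1 - v" "u = 2 / v - 1" using assms by (auto simp: v_def u_def field_simps)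
  have 1: "koebe_h z + koebe_g z = (u^3 - 1) / 6"
    unfolding koebe_h_def koebe_g_def v(3) using v(1)
    by (simp add: v(2) add_divide_distrib[symmetric]) (simp add: field_simps eval_nat_numeral)
  have 2: "koebe_h z - koebe_g z = (u^2 - 1) / 4"
    unfolding koebe_h_minus_koebe_g[OF assms(1)] v(3) using v(1)
    by (simp add: v(2)) (simp add: field_simps eval_nat_numeral)
  have "Re (harmonic_koebe z) = Re (koebe_h z + koebe_g z)"
    by (simp add: harmonic_koebe_eq)
  moreover have "Im (harmonic_koebe z) = Im (koebe_h z - koebe_g z)"
    by (simp add: harmonic_koebe_eq)
  ultimately show ?thesis
    unfolding 1 2 koebe_half_plane_def
    by (simp add: complex_eq_iff power2_eq_square power3_eq_cube algebra_simps)
qed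

lemma cayley_Re_pos:
  assumes "cmod z < 1"
  shows "0 < Re ((1 + z) / (1 - z))"
proof -
  have "z \<noteq> 1" using assms by auto
  then have "0 < (Re (1 - z))^2 + (Im (1 - z))^2"
    by (metis cmod_power2 norm_eq_zero right_minus_eq zero_less_power2)
  moreover have "(Re z)^2 + (Im z)^2 < 1"
    using assms by (simp add: cmod_power2[symmetric] power_less_one_iff)
  ultimately show ?thesis
    by (simp add: Re_divide zero_less_divide_iff) (simp add: algebra_simps power2_eq_square)
qed

lemma cayley_surj:
  assumes "0 < Re u"
  obtains z where "cmod z < 1" "u = (1 + z) / (1 - z)"
proof
  define z where "z = (u - 1) / (u + 1)"
  have nz: "u + 1 \<noteq> 0" using assms by (auto simp: complex_eq_iff)
  have "(cmod (u - 1))^2 < (cmod (u + 1))^2"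
    unfolding cmod_power2 using assms by (simp add: power2_eq_square algebra_simps)
  then have "cmod (u - 1) < cmod (u + 1)" by (rule power2_less_imp_less) simp
  then show "cmod ((u - 1) / (u + 1)) < 1" using nz by (simp add: norm_divide)
  show "u = (1 + (u - 1) / (u + 1)) / (1 - (u - 1) / (u + 1))"
  proof -
    have "1 + (u - 1) / (u + 1) = 2 * u / (u + 1)" "1 - (u - 1) / (u + 1) = 2 / (u + 1)"
      using nz by (simp_all add: field_simps)
    then show ?thesis using nz by simp
  qed
qed

lemma koebe_half_plane_inj:
  assumes eq: "koebe_half_plane x y = koebe_half_plane x' y'" and pos: "0 < x" "0 < x'"
  shows "x = x' \<and> y = y'"
proof -
  define t where "t = x * y"
  have t': "t = x' * y'" using eq by (simp add: koebe_half_plane_def t_def)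
  have e: "x^3 - 3 * x * y^2 = x'^3 - 3 * x' * y'^2" using eq by (simp add: koebe_half_plane_def)
  have "3 * x * y^2 = 3 * t^2 / x" using pos by (simp add: t_def power2_eq_square)
  moreover have "3 * x' * y'^2 = 3 * t^2 / x'" using pos by (simp add: t' power2_eq_square)
  ultimately have e': "x^3 - 3 * t^2 / x = x'^3 - 3 * t^2 / x'" using e by simp
  have mono: "a^3 - 3 * t^2 / a < b^3 - 3 * t^2 / b" if "0 < a" "a < b" for a b :: real
  proof -
    have "a^3 < b^3" using that by (intro power_strict_mono) auto
    moreover have "3 * t^2 / b \<le> 3 * t^2 / a" using that by (intro divide_left_mono) auto
    ultimately show ?thesis by linarith
  qed
  have "x = x'"
    using mono[of x x'] mono[of x' x] pos e' by (cases x x' rule: linorder_cases) auto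
  then show ?thesis using t' pos by (simp add: t_def)
qed

text \<open>On the real axis \<open>y = 0\<close>, so the real part is
  \<open>(x^3 - 1) / 6 > - 1/6\<close>, which gives the tip of the slit. Elsewhere, eliminating
  \<open>y = t / x\<close> with \<open>t = 2 * Im w\<close> leaves a quartic in \<open>x\<close>,
  solved by the intermediate value theorem.\<close>

lemma koebe_half_plane_range:
  "(\<exists>x y. 0 < x \<and> w = koebe_half_plane x y) \<longleftrightarrow> \<not> (Im w = 0 \<and> Re w \<le> - 1/6)"
proof
  assume "\<exists>x y. 0 < x \<and> w = koebe_half_plane x y"
  then obtain x y where xy: "0 < x" "w = koebe_half_plane x y" by blast
  show "\<not> (Im w = 0 \<and> Re w \<le> - 1/6)"
  proof
    assume *: "Im w = 0 \<and> Re w \<le> - 1/6"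
    then have "y = 0" using xy by (simp add: koebe_half_plane_def)
    then show False using * xy zero_less_power[of x 3] by (simp add: koebe_half_plane_def)
  qed
next
  assume w: "\<not> (Im w = 0 \<and> Re w \<le> - 1/6)"
  define s t where "s = 6 * Re w + 1" and "t = 2 * Im w"
  have "\<exists>x>0. x^4 = s * x + 3 * t^2"
  proof (cases "t = 0")
    case True
    then have "0 < s" using w by (simp add: s_def t_def)
    then have "root 3 s > 0" "(root 3 s)^4 = s * root 3 s"
      using real_root_pow_pos[of 3 s] by (simp_all add: power_eq_if[of _ 4])
    then show ?thesis using True by (intro exI[of _ "root 3 s"]) simp
  next
    case False
    define p where "p = (\<lambda>x::real. x^4 - s * x - 3 * t^2)"
    \<comment> \<open>Chosen so that \<open>s * B + 3 * t^2 \<le> (B - 1) * B \<le> B^4\<close>,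
      where \<open>1 \<le> B\<close> is used.\<close>
    define B where "B = 1 + \<bar>s\<bar> + 3 * t^2"
    have B: "1 \<le> B" by (simp add: B_def)
    have "p 0 \<le> 0" by (simp add: p_def)
    moreover have "0 \<le> p B"
    proof -
      have "s * B + 3 * t^2 \<le> (\<bar>s\<bar> + 3 * t^2) * B"
      proof -
        have "s * B \<le> \<bar>s\<bar> * B" using B by (intro mult_right_mono) auto
        moreover have "3 * t^2 * 1 \<le> 3 * t^2 * B" using B by (intro mult_left_mono) auto
        ultimately show ?thesis by (simp add: algebra_simps)
      qed
      also have "\<dots> \<le> B * B" using B by (intro mult_right_mono) (auto simp: B_def)
      also have "\<dots> \<le> B^4" using power_increasing[of 2 4 B] B by (simp add: power2_eq_square)
      finally show ?thesis by (simp add: p_def)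
    qed
    moreover have "continuous_on {0..B} p" unfolding p_def by (intro continuous_intros)
    ultimately obtain x where x: "0 \<le> x" "p x = 0"
      using IVT'[of p 0 0 B] B by auto
    have "x \<noteq> 0" using x False by (auto simp: p_def)
    then show ?thesis using x by (intro exI[of _ x]) (simp add: p_def)
  qed
  then obtain x where x: "0 < x" "x^4 = s * x + 3 * t^2" by blast
  define y where "y = t / x"
  have "x * (x^3 - 3 * x * y^2) = x^4 - 3 * (x * y)^2" by (simp add: algebra_simps eval_nat_numeral)
  also have "\<dots> = x * s" using x by (simp add: y_def)
  finally have "x^3 - 3 * x * y^2 = s" using x by simp
  moreover have "x * y = t" using x by (simp add: y_def)
  ultimately have "w = koebe_half_plane x y"
    by (simp add: koebe_half_plane_def s_def t_def complex_eq_iff)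
  then show "\<exists>x y. 0 < x \<and> w = koebe_half_plane x y" using x by blast
qed

lemma harmonic_koebe_inj: "inj_on harmonic_koebe unit_disk"
proof (rule inj_onI)
  fix z w assume z: "z \<in> unit_disk" and w: "w \<in> unit_disk" and eq: "harmonic_koebe z = harmonic_koebe w"
  define u v where "u = (1 + z) / (1 - z)" and "v = (1 + w) / (1 - w)"
  have nz: "1 - z \<noteq> 0" "1 - w \<noteq> 0" using z w by auto
  have "koebe_half_plane (Re u) (Im u) = koebe_half_plane (Re v) (Im v)"
    using eq nz harmonic_koebe_cayley[of z] harmonic_koebe_cayley[of w] by (simp add: u_def v_def)
  moreover have "0 < Re u" "0 < Re v"
    unfolding u_def v_def using z w by (auto intro!: cayley_Re_pos)
  ultimately have "u = v" using koebe_half_plane_inj by (metis complex_eqI)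
  then have "(1 + z) * (1 - w) = (1 + w) * (1 - z)"
    using nz by (simp add: u_def v_def frac_eq_eq)
  then show "z = w" by (simp add: algebra_simps)
qed

lemma harmonic_koebe_image: "harmonic_koebe ` unit_disk = - {w. Im w = 0 \<and> Re w \<le> - 1/6}"
proof -
  have "w \<in> harmonic_koebe ` unit_disk \<longleftrightarrow> (\<exists>x y. 0 < x \<and> w = koebe_half_plane x y)" for w
  proof
    assume "w \<in> harmonic_koebe ` unit_disk"
    then obtain z where z: "cmod z < 1" "w = harmonic_koebe z" by auto
    then show "\<exists>x y. 0 < x \<and> w = koebe_half_plane x y"
      using cayley_Re_pos[OF z(1)] harmonic_koebe_cayley[of z] by fastforce
  next
    assume "\<exists>x y. 0 < x \<and> w = koebe_half_plane x y"
    then obtain x y where xy: "0 < x" "w = koebe_half_plane x y" by blast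
    obtain z where z: "cmod z < 1" "Complex x y = (1 + z) / (1 - z)"
      using cayley_surj[of "Complex x y"] xy by auto
    have "w = harmonic_koebe z"
      using z xy harmonic_koebe_cayley[of z] by (metis complex.sel norm_one less_irrefl)
    then show "w \<in> harmonic_koebe ` unit_disk" using z by auto
  qed
  then show ?thesis
    by (intro set_eqI) (simp only: koebe_half_plane_range Compl_iff mem_Collect_eq)
qed

section \<open>Rotations and the equality cases\<close>

text \<open>The outer factor restores the normalisation of the derivative at 0. The angle is a free
  parameter, later matched to the argument of the affine coefficient.\<close>

definition rotated_koebe :: "real \<Rightarrow> complex \<Rightarrow> complex" where
  "rotated_koebe \<alpha> z = cis (- \<alpha>) * harmonic_koebe (cis \<alpha> * z)"

lemma rotated_koebe_0: "rotated_koebe 0 = harmonic_koebe"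
  by (simp add: rotated_koebe_def fun_eq_iff)

lemma cis_mult_neq_1:
  assumes "z \<in> unit_disk" shows "cis \<alpha> * z \<noteq> 1"
  using assms norm_mult[of "cis \<alpha>" z] by auto

text \<open>The dilatation is written as \<open>cis (2 * \<alpha>)\<close> times the rotated point,
  so that at \<open>cis (- \<alpha>) * r\<close> it is visibly
  \<open>cis (2 * \<alpha>) * r\<close>; only this phase has to be aligned.\<close>

lemma rotated_koebe_deriv:
  fixes \<alpha> :: real and z :: complex
  assumes "z \<in> unit_disk"
  defines "M \<equiv> (1 + cis \<alpha> * z) / (1 - cis \<alpha> * z)^4"
  shows "((\<lambda>z. cis (- \<alpha>) * koebe_h (cis \<alpha> * z)) has_field_derivative M) (at z)"
    and "((\<lambda>z. cis \<alpha> * koebe_g (cis \<alpha> * z)) has_field_derivative cis (2 * \<alpha>) * (cis \<alpha> * z) * M) (at z)"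
proof -
  have 1: "((\<lambda>z. cis \<alpha> * z) has_field_derivative cis \<alpha>) (at z)"
    by (auto intro!: derivative_eq_intros)
  have "((\<lambda>z. cis (- \<alpha>) * koebe_h (cis \<alpha> * z)) has_field_derivative cis (- \<alpha>) * (M * cis \<alpha>)) (at z)"
    unfolding M_def
    by (intro DERIV_cmult DERIV_chain2[OF koebe_h_deriv[OF cis_mult_neq_1[OF assms(1)]] 1])
  then show "((\<lambda>z. cis (- \<alpha>) * koebe_h (cis \<alpha> * z)) has_field_derivative M) (at z)"
    by (rule DERIV_cong) (simp add: mult.left_commute[of _ M] cis_mult)
  have "((\<lambda>z. cis \<alpha> * koebe_g (cis \<alpha> * z)) has_field_derivative
      cis \<alpha> * ((cis \<alpha> * z) * (1 + cis \<alpha> * z) / (1 - cis \<alpha> * z)^4 * cis \<alpha>)) (at z)"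
    by (intro DERIV_cmult DERIV_chain2[OF koebe_g_deriv[OF cis_mult_neq_1[OF assms(1)]] 1])
  then show "((\<lambda>z. cis \<alpha> * koebe_g (cis \<alpha> * z)) has_field_derivative cis (2 * \<alpha>) * (cis \<alpha> * z) * M) (at z)"
  proof (rule DERIV_cong)
    have "cis (2 * \<alpha>) = cis \<alpha> * cis \<alpha>" by (simp add: cis_mult)
    then show "cis \<alpha> * ((cis \<alpha> * z) * (1 + cis \<alpha> * z) / (1 - cis \<alpha> * z)^4 * cis \<alpha>)
        = cis (2 * \<alpha>) * (cis \<alpha> * z) * M" unfolding M_def by (simp only: mult_ac times_divide_eq_right)
  qed
qed

lemma rotated_koebe_parts:
  "harmonic_parts (rotated_koebe \<alpha>) (\<lambda>z. cis (- \<alpha>) * koebe_h (cis \<alpha> * z)) (\<lambda>z. cis \<alpha> * koebe_g (cis \<alpha> * z))"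
  unfolding harmonic_parts_def
proof (intro conjI ballI)
  show "(\<lambda>z. cis (- \<alpha>) * koebe_h (cis \<alpha> * z)) holomorphic_on unit_disk"
    unfolding holomorphic_on_open[OF open_ball] by (intro ballI exI) (rule rotated_koebe_deriv)
  show "(\<lambda>z. cis \<alpha> * koebe_g (cis \<alpha> * z)) holomorphic_on unit_disk"
    unfolding holomorphic_on_open[OF open_ball] by (intro ballI exI) (rule rotated_koebe_deriv)
  show "cis (- \<alpha>) * koebe_h (cis \<alpha> * 0) = 0" "cis \<alpha> * koebe_g (cis \<alpha> * 0) = 0"
    by (simp_all add: koebe_h_def koebe_g_def)
  show "deriv (\<lambda>z. cis (- \<alpha>) * koebe_h (cis \<alpha> * z)) 0 = 1"
    by (rule DERIV_imp_deriv, rule DERIV_cong, rule rotated_koebe_deriv(1)) auto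
  show "rotated_koebe \<alpha> z = cis (- \<alpha>) * koebe_h (cis \<alpha> * z) + cnj (cis \<alpha> * koebe_g (cis \<alpha> * z))" for z
    by (simp add: rotated_koebe_def harmonic_koebe_eq cis_cnj algebra_simps)
qed

lemma koebe_inj: "inj_on (\<lambda>z::complex. z / (1 - z)^2) unit_disk"
proof (rule inj_onI)
  fix z w :: complex assume z: "z \<in> unit_disk" and w: "w \<in> unit_disk"
    and eq: "z / (1 - z)^2 = w / (1 - w)^2"
  have nz: "1 - z \<noteq> 0" "1 - w \<noteq> 0" using z w by auto
  have "z * (1 - w)^2 = w * (1 - z)^2" using eq nz by (simp add: frac_eq_eq)
  moreover have "z * (1 - w)^2 - w * (1 - z)^2 = (z - w) * (1 - z * w)"
    by (simp add: power2_eq_square algebra_simps)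
  ultimately have "(z - w) * (1 - z * w) = 0" by (metis right_minus_eq)
  moreover have "1 - z * w \<noteq> 0"
  proof
    assume "1 - z * w = 0"
    then have "cmod z * cmod w = 1" by (metis norm_mult norm_one right_minus_eq)
    moreover have "cmod z * cmod w < 1 * 1" using z w by (intro mult_strict_mono') auto
    ultimately show False by simp
  qed
  ultimately show "z = w" by (metis mult_eq_0_iff right_minus_eq)
qed

lemma rotated_koebe_class_SH0_S: "rotated_koebe \<alpha> \<in> class_SH0_S"
proof -
  define h g where "h = (\<lambda>z. cis (- \<alpha>) * koebe_h (cis \<alpha> * z))" and "g = (\<lambda>z. cis \<alpha> * koebe_g (cis \<alpha> * z))"
  have P: "harmonic_parts (rotated_koebe \<alpha>) h g" using rotated_koebe_parts by (simp add: h_def g_def)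
  note dh = rotated_koebe_deriv(1)[of _ \<alpha>, folded h_def]
  note dg = rotated_koebe_deriv(2)[of _ \<alpha>, folded g_def]
  have rot: "cis \<alpha> * z \<in> unit_disk" if "z \<in> unit_disk" for z using that by (simp add: norm_mult)
  have "(cmod (deriv h z))\<^sup>2 - (cmod (deriv g z))\<^sup>2 > 0" if z: "z \<in> unit_disk" for z
  proof -
    define M where "M = (1 + cis \<alpha> * z) / (1 - cis \<alpha> * z)^4"
    have "cis \<alpha> * z \<noteq> -1" using rot[OF z] by auto
    then have "1 + cis \<alpha> * z \<noteq> 0" by (metis add_eq_0_iff)
    then have M: "0 < cmod M" using cis_mult_neq_1[OF z] by (simp add: M_def)
    have "deriv h z = M" "deriv g z = cis (2 * \<alpha>) * (cis \<alpha> * z) * M"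
      using DERIV_imp_deriv[OF dh[OF z]] DERIV_imp_deriv[OF dg[OF z]] by (simp_all add: M_def)
    then have "(cmod (deriv h z))\<^sup>2 - (cmod (deriv g z))\<^sup>2 = (1 - (cmod z)^2) * (cmod M)^2"
      by (simp add: norm_mult power_mult_distrib algebra_simps)
    moreover have "(cmod z)^2 < 1" using z by (simp add: power_less_one_iff)
    ultimately show ?thesis using M by simp
  qed
  then have sp: "sense_preserving (rotated_koebe \<alpha>)" unfolding sense_preserving_def using P by blast
  have inj: "inj_on (rotated_koebe \<alpha>) unit_disk"
  proof (rule inj_onI)
    fix z w assume z: "z \<in> unit_disk" and w: "w \<in> unit_disk" and "rotated_koebe \<alpha> z = rotated_koebe \<alpha> w"
    then have "harmonic_koebe (cis \<alpha> * z) = harmonic_koebe (cis \<alpha> * w)"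
      by (simp add: rotated_koebe_def)
    then have "cis \<alpha> * z = cis \<alpha> * w" by (rule inj_onD[OF harmonic_koebe_inj _ rot[OF z] rot[OF w]])
    then show "z = w" by simp
  qed
  have "deriv g 0 = 0"
    by (rule DERIV_imp_deriv, rule DERIV_cong, rule dg) auto
  then have "dzbar (rotated_koebe \<alpha>) 0 = 0" using dzbar_harmonic_parts[OF P, of 0] by simp
  then have "rotated_koebe \<alpha> \<in> class_SH0"
    using sp inj P by (auto simp: class_SH0_def class_SH_def class_H_def)
  \<comment> \<open>The angle \<open>pi - 2 * \<alpha>\<close> turns the outer factor of
    \<open>g\<close> into \<open>- cis (- \<alpha>)\<close>, so that the combination is a rotated
    classical Koebe function.\<close>
  moreover have "(\<lambda>z. h z + exp (\<i> * of_real (pi - 2 * \<alpha>)) * g z) \<in> class_S"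
  proof -
    define \<phi> where "\<phi> = (\<lambda>z. h z + exp (\<i> * of_real (pi - 2 * \<alpha>)) * g z)"
    have e: "exp (\<i> * of_real (pi - 2 * \<alpha>)) * cis \<alpha> = - cis (- \<alpha>)"
      unfolding cis_conv_exp[symmetric] cis_mult minus_cis by (simp add: add.commute)
    have eq: "\<phi> z = cis (- \<alpha>) * (cis \<alpha> * z / (1 - cis \<alpha> * z)^2)" if "z \<in> unit_disk" for z
      unfolding \<phi>_def h_def g_def mult.assoc[symmetric] e koebe_h_minus_koebe_g[OF cis_mult_neq_1[OF that], symmetric]
      by (simp add: algebra_simps)
    have "\<phi> holomorphic_on unit_disk"
      using P unfolding \<phi>_def harmonic_parts_def by (auto intro!: holomorphic_intros)
    moreover have "inj_on \<phi> unit_disk"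
    proof (rule inj_onI)
      fix z w assume z: "z \<in> unit_disk" and w: "w \<in> unit_disk" and "\<phi> z = \<phi> w"
      then have "cis \<alpha> * z / (1 - cis \<alpha> * z)^2 = cis \<alpha> * w / (1 - cis \<alpha> * w)^2"
        unfolding eq[OF z] eq[OF w] by (metis cis_neq_zero mult_left_cancel)
      then have "cis \<alpha> * z = cis \<alpha> * w" by (rule inj_onD[OF koebe_inj _ rot[OF z] rot[OF w]])
      then show "z = w" by simp
    qed
    moreover have "\<phi> 0 = 0" by (simp add: eq)
    moreover have "deriv \<phi> 0 = 1"
    proof (rule DERIV_imp_deriv)
      show "(\<phi> has_field_derivative 1) (at 0)" unfolding \<phi>_def
        by (rule DERIV_cong[OF DERIV_add[OF dh DERIV_cmult[OF dg]]]) auto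
    qed
    ultimately show ?thesis unfolding class_S_def \<phi>_def by blast
  qed
  ultimately show ?thesis unfolding class_SH0_S_def using P by blast
qed

lemma koebe_affine_close_to_convex_domain:
  assumes b: "cmod b < 1"
  shows "close_to_convex_domain (koebe_affine b ` unit_disk)"
proof -
  define A where "A = ellipse_map (- cnj b)"
  have bij: "bij A" unfolding A_def using b by (intro bij_ellipse_map) simp
  have lin: "linear A" unfolding A_def by (rule ellipse_map_linear)
  define S where "S = {w. Im w = 0 \<and> Re w \<le> - 1/6}"
  have "koebe_affine b = A \<circ> harmonic_koebe"
    by (simp add: fun_eq_iff koebe_affine_def A_def ellipse_map_def)
  then have im: "koebe_affine b ` unit_disk = A ` (- S)"
    unfolding S_def harmonic_koebe_image[symmetric] by (simp add: image_comp)
  have "closed {w. Im w = 0}" "closed {w. Re w \<le> - 1/6}"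
    by (auto intro!: closed_Collect_eq closed_Collect_le continuous_intros)
  then have "closed S" unfolding S_def Collect_conj_eq by (rule closed_Int)
  then have op: "open (A ` (- S))"
    by (intro open_surjective_linear_image lin) (use bij in \<open>auto simp: bij_def\<close>)
  have "continuous_on unit_disk (koebe_affine b)"
    unfolding koebe_affine_def harmonic_koebe_def by (intro continuous_intros) auto
  then have conn: "connected (koebe_affine b ` unit_disk)"
    by (rule connected_continuous_image) (simp add: convex_connected)
  have "- (A ` (- S)) = A ` S" using bij_image_Compl_eq[OF bij, of S] by simp
  also have "A ` S = {A (- 1/6) + of_real t * A (- 1) | t::real. t \<ge> 0}"
  proof -
    have S: "S = {- 1/6 + t *\<^sub>R (- 1) | t::real. t \<ge> 0}"
    proof (intro equalityI subsetI)
      fix w assume "w \<in> S"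
      then have "w = - 1/6 + (- 1/6 - Re w) *\<^sub>R (- 1)" "- 1/6 - Re w \<ge> 0"
        by (auto simp: S_def complex_eq_iff)
      then show "w \<in> {- 1/6 + t *\<^sub>R (- 1) | t::real. t \<ge> 0}" by blast
    qed (auto simp: S_def)
    have "A (- 1/6 + t *\<^sub>R (- 1)) = A (- 1/6) + of_real t * A (- 1)" for t
      unfolding linear_add[OF lin] linear_scale[OF lin] by (simp only: scaleR_conv_of_real)
    then show ?thesis unfolding S by (auto simp: image_iff) metis+
  qed
  finally have compl: "- (A ` (- S)) = {A (- 1/6) + of_real t * A (- 1) | t::real. t \<ge> 0}" .
  have "A (- 1) \<noteq> A 0" using bij by (simp add: bij_def inj_eq)
  then have "A (- 1) \<noteq> 0" using linear_0[OF lin] by simp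
  then have "closed_half_line (- (A ` (- S)))"
    unfolding closed_half_line_def using compl by blast
  \<comment> \<open>The complement is a single half-line, the affine image of the slit, so the
    family has one member and pairwise disjointness is vacuous.\<close>
  then show ?thesis
    unfolding close_to_convex_domain_def im
    using op conn[unfolded im] im
    by (intro conjI exI[of _ "{- (A ` (- S))}"]) auto
qed

lemma koebe_affine_eq: "koebe_affine b z = harmonic_koebe z + cnj b * cnj (harmonic_koebe z)"
  by (simp add: koebe_affine_def)

lemma class_SH_S_I:
  assumes "f0 \<in> class_SH0_S" "cmod c < 1" "\<forall>z\<in>unit_disk. f z = f0 z + c * cnj (f0 z)"
  shows "f \<in> class_SH_S"
  using assms unfolding class_SH_S_def by (auto intro!: bexI[of _ f0] bexI[of _ c])

text \<open>Assumption \<open>c\<close> aligns the phases: on the ray of angle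
  \<open>- \<alpha>\<close> the two terms in each derivative have the same argument, so both
  triangle inequalities become equalities, for all \<open>r\<close> at once.\<close>

lemma affine_rotated_koebe_at_extremal_point:
  assumes f: "\<forall>z\<in>unit_disk. f z = rotated_koebe \<alpha> z + c * cnj (rotated_koebe \<alpha> z)"
    and c: "c * cis (2 * \<alpha>) = of_real (cmod c)"
  obtains h g where "harmonic_parts f h g" "dzbar f 0 = c"
    "\<And>r. 0 < r \<Longrightarrow> r < 1 \<Longrightarrow> cmod (deriv h (cis (- \<alpha>) * of_real r)) = (1 + r * cmod c) * ((1 + r) / (1 - r)^4)"
    "\<And>r. 0 < r \<Longrightarrow> r < 1 \<Longrightarrow> cmod (deriv g (cis (- \<alpha>) * of_real r)) = (r + cmod c) * ((1 + r) / (1 - r)^4)"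
proof -
  note P0 = rotated_koebe_parts[of \<alpha>]
  have g0: "deriv (\<lambda>z. cis \<alpha> * koebe_g (cis \<alpha> * z)) 0 = 0"
    by (rule DERIV_imp_deriv, rule DERIV_cong, rule rotated_koebe_deriv(2)) auto
  have h0: "deriv (\<lambda>z. cis (- \<alpha>) * koebe_h (cis \<alpha> * z)) 0 = 1"
    using P0 by (simp add: harmonic_parts_def)
  note aff = harmonic_parts_affine[OF P0 g0 f]
  show ?thesis
  proof (rule that[OF aff(1)])
    show "dzbar f 0 = c"
      using dzbar_harmonic_parts[OF aff(1), of 0] aff(3)[of 0] g0 h0 by simp
    fix r :: real assume r: "0 < r" "r < 1"
    define z where "z = cis (- \<alpha>) * of_real r"
    have z: "z \<in> unit_disk" using r by (simp add: z_def norm_mult)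
    have ez: "cis \<alpha> * z = of_real r" unfolding z_def mult.assoc[symmetric] cis_mult by simp
    define M where "M = (1 + r) / (1 - r)^4"
    have M: "0 \<le> M" using r by (simp add: M_def)
    have MM: "(1 + of_real r) / (1 - of_real r)^4 = (of_real M :: complex)"
      unfolding M_def by simp
    note d0 = DERIV_imp_deriv[OF rotated_koebe_deriv(1)[OF z, of \<alpha>]] DERIV_imp_deriv[OF rotated_koebe_deriv(2)[OF z, of \<alpha>]]
    have "deriv (\<lambda>z. cis (- \<alpha>) * koebe_h (cis \<alpha> * z) + c * (cis \<alpha> * koebe_g (cis \<alpha> * z))) z
        = of_real M + c * (cis (2 * \<alpha>) * of_real r * of_real M)"
      using aff(2)[OF z] unfolding d0 ez MM .
    also have "\<dots> = of_real M + (c * cis (2 * \<alpha>)) * (of_real r * of_real M)" by (simp only: mult_ac)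
    also have "\<dots> = of_real ((1 + r * cmod c) * M)" unfolding c by (simp add: algebra_simps)
    finally show "cmod (deriv (\<lambda>z. cis (- \<alpha>) * koebe_h (cis \<alpha> * z) + c * (cis \<alpha> * koebe_g (cis \<alpha> * z))) (cis (- \<alpha>) * of_real r))
        = (1 + r * cmod c) * ((1 + r) / (1 - r)^4)"
      unfolding z_def[symmetric] M_def[symmetric] using M r by (simp only: norm_of_real) simp
    \<comment> \<open>Conjugating \<open>c\<close> gives \<open>cnj c\<close> the phase
      \<open>cis (2 * \<alpha>)\<close>, the one carried by the co-analytic term.\<close>
    have "cnj c * cis (- 2 * \<alpha>) = of_real (cmod c)"
      using arg_cong[OF c, of cnj] by (simp add: cis_cnj)
    then have "cis (2 * \<alpha>) * (cnj c * cis (- 2 * \<alpha>)) = cis (2 * \<alpha>) * of_real (cmod c)" by simp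
    moreover have "cis (2 * \<alpha>) * (cnj c * cis (- 2 * \<alpha>)) = cnj c * (cis (2 * \<alpha>) * cis (- 2 * \<alpha>))"
      by (simp only: mult_ac)
    ultimately have cc: "cnj c = cis (2 * \<alpha>) * of_real (cmod c)" by (simp add: cis_mult)
    have "deriv (\<lambda>z. cis \<alpha> * koebe_g (cis \<alpha> * z) + cnj c * (cis (- \<alpha>) * koebe_h (cis \<alpha> * z))) z
        = cis (2 * \<alpha>) * of_real r * of_real M + cnj c * of_real M"
      using aff(3)[OF z] unfolding d0 ez MM .
    also have "\<dots> = cis (2 * \<alpha>) * of_real ((r + cmod c) * M)" unfolding cc by (simp add: algebra_simps)
    finally show "cmod (deriv (\<lambda>z. cis \<alpha> * koebe_g (cis \<alpha> * z) + cnj c * (cis (- \<alpha>) * koebe_h (cis \<alpha> * z))) (cis (- \<alpha>) * of_real r))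
        = (r + cmod c) * ((1 + r) / (1 - r)^4)"
      unfolding z_def[symmetric] M_def[symmetric] using M r by (simp only: norm_mult norm_cis norm_of_real) simp
  qed
qed

lemma koebe_affine_classes:
  assumes b: "b \<in> unit_disk"
  shows "koebe_affine b \<in> class_SH_S" "close_to_convex (koebe_affine b)" "dzbar (koebe_affine b) 0 = cnj b"
proof -
  have b': "cmod b < 1" using b by simp
  have K: "harmonic_koebe \<in> class_SH0_S" using rotated_koebe_class_SH0_S[of 0] by (simp add: rotated_koebe_0)
  show "koebe_affine b \<in> class_SH_S"
    using class_SH_S_I[OF K, of "cnj b"] b' koebe_affine_eq by simp
  have "koebe_affine b \<in> class_SH"
    using affine_class_SH[of harmonic_koebe "cnj b"] K b' koebe_affine_eq by (simp add: class_SH0_S_def)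
  then show "close_to_convex (koebe_affine b)"
    using koebe_affine_close_to_convex_domain[OF b'] by (simp add: close_to_convex_def)
  note P0 = rotated_koebe_parts[of 0, unfolded rotated_koebe_0]
  have g0: "deriv (\<lambda>z. cis 0 * koebe_g (cis 0 * z)) 0 = 0"
    by (rule DERIV_imp_deriv, rule DERIV_cong, rule rotated_koebe_deriv(2)) auto
  have h0: "deriv (\<lambda>z. cis (- 0) * koebe_h (cis 0 * z)) 0 = 1"
    using P0 by (simp add: harmonic_parts_def)
  note aff = harmonic_parts_affine[OF P0 g0 ballI[OF koebe_affine_eq]]
  show "dzbar (koebe_affine b) 0 = cnj b"
    using dzbar_harmonic_parts[OF aff(1), of 0] aff(3)[of 0] g0 h0 by simp
qed

theorem theorem4:
  shows
   "(\<forall>f h g z r b. f \<in> class_SH_S \<and> harmonic_parts f h g \<and> b = dzbar f 0 \<and>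
        cmod z = r \<and> 0 < r \<and> r < 1 \<longrightarrow>
        cmod (deriv h z) \<le> (1 + r * cmod b) * ((1 + r) / (1 - r)^4) \<and>
        cmod (deriv g z) \<le> (r + cmod b) * ((1 + r) / (1 - r)^4))
    \<and>
    (\<forall>b\<in>unit_disk. \<exists>f\<in>class_SH_S. dzbar f 0 = b \<and>
        (\<exists>h g. harmonic_parts f h g \<and>
           (\<forall>r::real. 0 < r \<and> r < 1 \<longrightarrow>
              (\<exists>z. cmod z = r \<and>
                 cmod (deriv h z) = (1 + r * cmod b) * ((1 + r) / (1 - r)^4) \<and>
                 cmod (deriv g z) = (r + cmod b) * ((1 + r) / (1 - r)^4)))))
    \<and>
    (\<forall>b\<in>unit_disk. koebe_affine b \<in> class_SH_S \<and> close_to_convex (koebe_affine b) \<and>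
        dzbar (koebe_affine b) 0 = cnj b)
    \<and>
    (\<forall>b::real. 0 \<le> b \<and> b < 1 \<longrightarrow>
        (\<exists>h g. harmonic_parts (koebe_affine (of_real b)) h g \<and>
           (\<forall>r::real. 0 < r \<and> r < 1 \<longrightarrow>
              cmod (deriv h (of_real r)) = (1 + r * b) * ((1 + r) / (1 - r)^4) \<and>
              cmod (deriv g (of_real r)) = (r + b) * ((1 + r) / (1 - r)^4))))"
proof (intro conjI)
  show "\<forall>f h g z r b. f \<in> class_SH_S \<and> harmonic_parts f h g \<and> b = dzbar f 0 \<and>
        cmod z = r \<and> 0 < r \<and> r < 1 \<longrightarrow>
        cmod (deriv h z) \<le> (1 + r * cmod b) * ((1 + r) / (1 - r)^4) \<and>
        cmod (deriv g z) \<le> (r + cmod b) * ((1 + r) / (1 - r)^4)"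
    using class_SH_S_deriv_bounds by blast
next
  show "\<forall>b\<in>unit_disk. \<exists>f\<in>class_SH_S. dzbar f 0 = b \<and>
        (\<exists>h g. harmonic_parts f h g \<and>
           (\<forall>r::real. 0 < r \<and> r < 1 \<longrightarrow>
              (\<exists>z. cmod z = r \<and>
                 cmod (deriv h z) = (1 + r * cmod b) * ((1 + r) / (1 - r)^4) \<and>
                 cmod (deriv g z) = (r + cmod b) * ((1 + r) / (1 - r)^4))))"
  proof
    fix b :: complex assume b: "b \<in> unit_disk"
    \<comment> \<open>Half the argument, because the phase to be cancelled is
      \<open>cis (2 * \<alpha>)\<close>.\<close>
    define \<alpha> where "\<alpha> = - Arg b / 2"
    define f where "f = (\<lambda>z. rotated_koebe \<alpha> z + b * cnj (rotated_koebe \<alpha> z))"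
    have "b * cis (2 * \<alpha>) = of_real (cmod b) * (cis (Arg b) * cis (2 * \<alpha>))"
      by (metis mult.assoc rcis_cmod_Arg rcis_def)
    then have c: "b * cis (2 * \<alpha>) = of_real (cmod b)"
      unfolding cis_mult by (simp add: \<alpha>_def)
    have "f \<in> class_SH_S"
      using b by (intro class_SH_S_I[OF rotated_koebe_class_SH0_S]) (auto simp: f_def)
    moreover obtain h g where hg: "harmonic_parts f h g" "dzbar f 0 = b"
      "\<And>r. 0 < r \<Longrightarrow> r < 1 \<Longrightarrow> cmod (deriv h (cis (- \<alpha>) * of_real r)) = (1 + r * cmod b) * ((1 + r) / (1 - r)^4)"
      "\<And>r. 0 < r \<Longrightarrow> r < 1 \<Longrightarrow> cmod (deriv g (cis (- \<alpha>) * of_real r)) = (r + cmod b) * ((1 + r) / (1 - r)^4)"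
      by (rule affine_rotated_koebe_at_extremal_point[of f \<alpha> b]) (auto simp: f_def c)
    moreover have "\<exists>z. cmod z = r \<and>
                 cmod (deriv h z) = (1 + r * cmod b) * ((1 + r) / (1 - r)^4) \<and>
                 cmod (deriv g z) = (r + cmod b) * ((1 + r) / (1 - r)^4)" if "0 < r \<and> r < 1" for r
      using hg(3,4)[of r] that by (intro exI[of _ "cis (- \<alpha>) * of_real r"]) (simp add: norm_mult)
    ultimately show "\<exists>f\<in>class_SH_S. dzbar f 0 = b \<and>
        (\<exists>h g. harmonic_parts f h g \<and>
           (\<forall>r::real. 0 < r \<and> r < 1 \<longrightarrow>
              (\<exists>z. cmod z = r \<and>
                 cmod (deriv h z) = (1 + r * cmod b) * ((1 + r) / (1 - r)^4) \<and>
                 cmod (deriv g z) = (r + cmod b) * ((1 + r) / (1 - r)^4))))"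
      by blast
  qed
next
  show "\<forall>b\<in>unit_disk. koebe_affine b \<in> class_SH_S \<and> close_to_convex (koebe_affine b) \<and>
        dzbar (koebe_affine b) 0 = cnj b"
    using koebe_affine_classes by blast
next
  show "\<forall>b::real. 0 \<le> b \<and> b < 1 \<longrightarrow>
        (\<exists>h g. harmonic_parts (koebe_affine (of_real b)) h g \<and>
           (\<forall>r::real. 0 < r \<and> r < 1 \<longrightarrow>
              cmod (deriv h (of_real r)) = (1 + r * b) * ((1 + r) / (1 - r)^4) \<and>
              cmod (deriv g (of_real r)) = (r + b) * ((1 + r) / (1 - r)^4)))"
  proof (intro allI impI)
    fix b :: real assume b: "0 \<le> b \<and> b < 1"
    \<comment> \<open>For \<open>b \<ge> 0\<close> the phases are aligned without a rotation, so
      \<open>\<alpha> = 0\<close> and the extremal point is \<open>r\<close> itself.\<close>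
    obtain h g where hg: "harmonic_parts (koebe_affine (of_real b)) h g"
      "\<And>r. 0 < r \<Longrightarrow> r < 1 \<Longrightarrow> cmod (deriv h (cis (- 0) * of_real r)) = (1 + r * cmod (of_real b)) * ((1 + r) / (1 - r)^4)"
      "\<And>r. 0 < r \<Longrightarrow> r < 1 \<Longrightarrow> cmod (deriv g (cis (- 0) * of_real r)) = (r + cmod (of_real b)) * ((1 + r) / (1 - r)^4)"
      by (rule affine_rotated_koebe_at_extremal_point[of "koebe_affine (of_real b)" 0 "of_real b"])
         (use b in \<open>auto simp: rotated_koebe_0 koebe_affine_eq\<close>)
    then show "\<exists>h g. harmonic_parts (koebe_affine (of_real b)) h g \<and>
           (\<forall>r::real. 0 < r \<and> r < 1 \<longrightarrow>
              cmod (deriv h (of_real r)) = (1 + r * b) * ((1 + r) / (1 - r)^4) \<and>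
              cmod (deriv g (of_real r)) = (r + b) * ((1 + r) / (1 - r)^4))"
      using b by (intro exI[of _ h] exI[of _ g]) simp
  qed
qed

end
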